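(* Fix a real number $\delta$. For each $n\geq 1$, let $\mathcal{P}_n$ be the finite set of plane partitions of size $n$, equipped with the uniform probability measure, and define random variables on $\mathcal{P}_n$ by \[ X_n^+(\pi)=\frac{w_+(\pi)}{n^{2/3}},\qquad X_n^-(\pi)=\frac{w_-(\pi)}{n^{2/3}},\qquad X_n^0(\pi)=\frac{w_0(\pi)}{n^{2/3}}. \] Then, as $n\to\infty$, the distribution of the random variable $\delta\cdot X_n^0+X_n^+-X_n^-$ has the Gaussian (normal) distribution as limit law, with mean \[ \mu=\frac{\delta\,\zeta(2)}{(2\zeta(3))^{2/3}} \] and variance \[ \sigma^2=\frac{1}{(2\zeta(3))^{1/3}}. \]
   Context: A plane partition $\pi$ is an array $(\pi_{i,j})_{i,j\geq 0}$ of nonnegative integers, only finitely many nonzero, that is weakly decreasing in each index: $\pi_{i,j}\geq \pi_{i+1,j}$ and $\pi_{i,j}\geq\pi_{i,j+1}$. Its size is $|\pi|=\sum_{i,j}\pi_{i,j}$. The statistics used are $w_+(\pi)=\sum_{i<j}\pi_{i,j}$, $w_-(\pi)=\sum_{i>j}\pi_{i,j}$, and $w_0(\pi)=\sum_i \pi_{i,i}$ (the trace). $\zeta$ denotes the Riemann zeta function. *)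

theory Defs
  imports "HOL-Probability.Probability"
begin

definition plane_partition :: "(nat \<Rightarrow> nat \<Rightarrow> nat) \<Rightarrow> bool" where
  "plane_partition p \<longleftrightarrow>
     finite {(i, j). p i j \<noteq> 0} \<and>
     (\<forall>i j. p (Suc i) j \<le> p i j) \<and> (\<forall>i j. p i (Suc j) \<le> p i j)"

definition pp_support :: "(nat \<Rightarrow> nat \<Rightarrow> nat) \<Rightarrow> (nat \<times> nat) set" where
  "pp_support p = {(i, j). p i j \<noteq> 0}"

definition pp_size :: "(nat \<Rightarrow> nat \<Rightarrow> nat) \<Rightarrow> nat" where
  "pp_size p = (\<Sum>(i, j)\<in>pp_support p. p i j)"

definition w_plus :: "(nat \<Rightarrow> nat \<Rightarrow> nat) \<Rightarrow> nat" where
  "w_plus p = (\<Sum>(i, j)\<in>{(i, j)\<in>pp_support p. i < j}. p i j)"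

definition w_minus :: "(nat \<Rightarrow> nat \<Rightarrow> nat) \<Rightarrow> nat" where
  "w_minus p = (\<Sum>(i, j)\<in>{(i, j)\<in>pp_support p. i > j}. p i j)"

definition w_zero :: "(nat \<Rightarrow> nat \<Rightarrow> nat) \<Rightarrow> nat" where
  "w_zero p = (\<Sum>(i, j)\<in>{(i, j)\<in>pp_support p. i = j}. p i j)"

definition plane_partitions :: "nat \<Rightarrow> (nat \<Rightarrow> nat \<Rightarrow> nat) set" where
  "plane_partitions n = {p. plane_partition p \<and> pp_size p = n}"

definition zeta_real :: "real \<Rightarrow> real" where
  "zeta_real s = (\<Sum>k. 1 / (real (Suc k)) powr s)"

definition pp_law :: "real \<Rightarrow> nat \<Rightarrow> real measure" where
  "pp_law \<delta> n = distr (measure_pmf (pmf_of_set (plane_partitions n))) borel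
     (\<lambda>p. (\<delta> * real (w_zero p) + real (w_plus p) - real (w_minus p)) / real n powr (2/3))"

end

theory Submission
  imports Defs "HOL-Real_Asymp.Real_Asymp"
begin

text \<open>
  The local rule of RSK, applied along the diagonals of a plane partition, turns it into a finitely
  supported matrix \<open>N\<close> with size \<open>\<Sum> (a + b + 1) N a b\<close>, \<open>w_plus - w_minus = \<Sum> (b - a) N a b\<close> and
  \<open>w_zero = \<Sum> N a b\<close>. Hence the joint generating function of size and statistic is a product of
  geometric series, and the characteristic function of the statistic on partitions of size \<open>n\<close> is a
  quotient of two coefficient integrals over the circle of radius \<open>exp (- s)\<close>. We take
  \<open>s = (2 \<zeta>(3) / n) powr (1/3)\<close> and rescale the angle as \<open>x s\<^sup>2\<close> and the frequency as \<open>y s\<^sup>2\<close>. The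
  logarithm of the product is a series \<open>\<Sum>k. A(k s, k t, k u) / k\<close> whose terms have a second order
  Taylor expansion with a uniform error, so Tannery's theorem yields the limiting exponent
  \<open>\<i> \<delta> y \<zeta>(2) - (3 x\<^sup>2 + y\<^sup>2) \<zeta>(3)\<close>. The term \<open>k = 1\<close> alone supplies an integrable dominating
  function, so the integrals converge, and Levy's continuity theorem concludes.
\<close>

text \<open>The scale comes from fluctuations. Under the weight \<open>exp (- s * size)\<close> the
  size has variance about \<open>6 * zeta(3) / s ^ 4\<close> and \<open>w_plus - w_minus\<close>
  about \<open>2 * zeta(3) / s ^ 4\<close>, so angle and frequency both act at scale
  \<open>s\<^sup>2\<close>, which is of order \<open>n powr (- 2 / 3)\<close>. The variance of the
  trace and its covariance with the size are of smaller order, so the trace contributes only its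
  mean, about \<open>zeta(2) / s\<^sup>2\<close>; this is why \<delta> enters the limiting mean but
  not the variance. Transposition symmetry makes size and \<open>w_plus - w_minus\<close>
  uncorrelated, so the limiting Gaussian integral in \<open>x\<close> separates from
  \<open>y\<close>. At frequency 0 the coefficient integral counts the partitions of
  \<open>n\<close>. Taking the quotient cancels all prefactors, so no asymptotic count enters. The
  main obstacle is domination: the rescaled circle has length of order \<open>1 / s\<^sup>2\<close>,
  and away from the centre the logarithm drops only by that same order. The majorant must therefore
  decay like the exponential of a multiple of \<open>\<bar>x\<bar>\<close>, and one such bound
  covers the whole circle.\<close>

section \<open>Plane partitions and matrices\<close>

text \<open>\<open>D a b\<close> is the partition attached to the vertex \<open>(a, b)\<close> of a growth diagram, \<open>r\<close> indexing its
  parts; the diagonals of a plane partition sit on the two axes. Cells and vertices are numbered so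
  that the diagram is empty far from the origin.\<close>

definition growth :: "(nat \<Rightarrow> nat \<Rightarrow> nat \<Rightarrow> nat) \<Rightarrow> bool" where
  "growth D \<longleftrightarrow>
     (\<exists>L. \<forall>a b r. D a b r \<noteq> 0 \<longrightarrow> a < L \<and> b < L \<and> r < L) \<and>
     (\<forall>a b r. D (Suc a) b r \<le> D a b r \<and> D a b (Suc r) \<le> D (Suc a) b r) \<and>
     (\<forall>a b r. D a (Suc b) r \<le> D a b r \<and> D a b (Suc r) \<le> D a (Suc b) r) \<and>
     (\<forall>a b r. D (Suc a) (Suc b) r + D a b (Suc r) =
        min (D (Suc a) b r) (D a (Suc b) r) + max (D (Suc a) b (Suc r)) (D a (Suc b) (Suc r)))"

text \<open>In the local rule the first part at a vertex is the maximum of its two outer neighbours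
  plus the number stored in the cell. All later parts are governed by the last clause of
  \<open>growth\<close>, where no cell occurs.\<close>

definition cells :: "(nat \<Rightarrow> nat \<Rightarrow> nat \<Rightarrow> nat) \<Rightarrow> nat \<Rightarrow> nat \<Rightarrow> nat" where
  "cells D a b = D a b 0 - max (D (Suc a) b 0) (D a (Suc b) 0)"

text \<open>The axes carry the diagonals of \<open>p\<close>; the last clause of
  \<open>growth\<close>, solved for the outer corner, propagates them away from the origin. The
  subtraction on natural numbers is exact only because of interlacing, shown in
  \<open>growth_diagonals\<close>.\<close>

fun diagonals :: "(nat \<Rightarrow> nat \<Rightarrow> nat) \<Rightarrow> nat \<Rightarrow> nat \<Rightarrow> nat \<Rightarrow> nat" where
  "diagonals p 0 b r = p r (r + b)"
| "diagonals p (Suc a) 0 r = p (r + Suc a) r"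
| "diagonals p (Suc a) (Suc b) r =
     min (diagonals p (Suc a) b r) (diagonals p a (Suc b) r)
     + max (diagonals p (Suc a) b (Suc r)) (diagonals p a (Suc b) (Suc r))
     - diagonals p a b (Suc r)"

section \<open>From a plane partition to a growth diagram\<close>

lemma diagonals_0_right: "diagonals p a 0 r = p (r + a) r"
  by (cases a) auto

lemma growthD:
  assumes "growth D"
  shows "D (Suc a) b r \<le> D a b r" "D a b (Suc r) \<le> D (Suc a) b r"
    "D a (Suc b) r \<le> D a b r" "D a b (Suc r) \<le> D a (Suc b) r"
    "D (Suc a) (Suc b) r + D a b (Suc r) =
       min (D (Suc a) b r) (D a (Suc b) r) + max (D (Suc a) b (Suc r)) (D a (Suc b) (Suc r))"
  using assms unfolding growth_def by auto

lemma growth_cells: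
  "growth D \<Longrightarrow> D a b 0 = cells D a b + max (D (Suc a) b 0) (D a (Suc b) 0)"
  unfolding cells_def using growthD(1,3)[of D a b 0] by auto

lemma growth_support:
  "growth D \<Longrightarrow> \<exists>L. \<forall>a b r. D a b r \<noteq> 0 \<longrightarrow> a < L \<and> b < L \<and> r < L"
  unfolding growth_def by blast

text \<open>Interlacing on the two edges leaving \<open>(a, b)\<close> passes to the two opposite
  edges of the unit square. Monotonicity of \<open>p\<close> gives interlacing along the axes, and a
  double induction covers the quadrant.\<close>

lemma growth_diagonals:
  assumes "plane_partition p"
  shows "growth (diagonals p)"
proof -
  let ?D = "diagonals p"
  have pp: "p (Suc i) j \<le> p i j" "p i (Suc j) \<le> p i j" for i j
    using assms unfolding plane_partition_def by auto
  have ppd: "p (Suc i) (Suc j) \<le> p i j" for i j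
    using pp(1)[of i "Suc j"] pp(2)[of i j] by simp
  have fin: "finite {(i, j). p i j \<noteq> 0}"
    using assms unfolding plane_partition_def by auto
  \<comment> \<open>\<open>V a b\<close> and \<open>H a b\<close> say that the partitions at the two
    ends of the edge from \<open>(a, b)\<close> to \<open>(Suc a, b)\<close>, respectively
    \<open>(a, Suc b)\<close>, interlace.\<close>
  define V where "V a b \<longleftrightarrow> (\<forall>r. ?D (Suc a) b r \<le> ?D a b r \<and> ?D a b (Suc r) \<le> ?D (Suc a) b r)" for a b
  define H where "H a b \<longleftrightarrow> (\<forall>r. ?D a (Suc b) r \<le> ?D a b r \<and> ?D a b (Suc r) \<le> ?D a (Suc b) r)" for a b
  have step: "V a (Suc b) \<and> H (Suc a) b \<and>
      (\<forall>r. ?D (Suc a) (Suc b) r + ?D a b (Suc r) =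
        min (?D (Suc a) b r) (?D a (Suc b) r) + max (?D (Suc a) b (Suc r)) (?D a (Suc b) (Suc r)))"
    if "V a b" "H a b" for a b
  proof -
    have v: "?D (Suc a) b r \<le> ?D a b r" "?D a b (Suc r) \<le> ?D (Suc a) b r"
        and h: "?D a (Suc b) r \<le> ?D a b r" "?D a b (Suc r) \<le> ?D a (Suc b) r" for r
      using that unfolding V_def H_def by auto
    \<comment> \<open>The subtracted part lies between the maximum and the minimum that are added:
      so nothing is truncated, and the new part again lies between its neighbours.\<close>
    have 1: "max (?D (Suc a) b (Suc r)) (?D a (Suc b) (Suc r)) \<le> ?D a b (Suc r)"
      "?D a b (Suc r) \<le> min (?D (Suc a) b r) (?D a (Suc b) r)" for r
      using v h by auto
    then have eq: "?D (Suc a) (Suc b) r + ?D a b (Suc r) =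
        min (?D (Suc a) b r) (?D a (Suc b) r) + max (?D (Suc a) b (Suc r)) (?D a (Suc b) (Suc r))" for r
      using trans_le_add1[OF 1(2)[of r]] by (simp del: min.bounded_iff)
    have 2: "?D (Suc a) (Suc b) r \<le> min (?D (Suc a) b r) (?D a (Suc b) r)"
        "max (?D (Suc a) b (Suc r)) (?D a (Suc b) (Suc r)) \<le> ?D (Suc a) (Suc b) r" for r
      using 1[of r] eq[of r] by linarith+
    then show ?thesis using eq unfolding V_def H_def by auto
  qed
  have H0: "H 0 b" for b
    unfolding H_def using ppd pp by simp
  have V0: "V a 0" for a
    unfolding V_def diagonals_0_right using ppd pp by simp
  have HV: "(\<forall>b. H a b) \<and> (\<forall>b. V a b)" for a
  proof (induction a)
    case 0
    have "V 0 b" for b by (induction b) (use V0 H0 step in auto)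
    then show ?case using H0 by auto
  next
    case (Suc a)
    then have H: "H (Suc a) b" for b using step by auto
    have "V (Suc a) b" for b by (induction b) (use V0 H step in auto)
    then show ?case using H by auto
  qed
  obtain L where L: "\<And>i j. p i j \<noteq> 0 \<Longrightarrow> i < L \<and> j < L"
  proof -
    obtain K where K: "fst ` {(i, j). p i j \<noteq> 0} \<union> snd ` {(i, j). p i j \<noteq> 0} \<subseteq> {..<K}"
      using finite_nat_iff_bounded fin by (metis finite_UnI finite_imageI)
    show ?thesis by (rule that[of K]) (use K in force)
  qed
  have mono1: "?D a b r \<le> ?D 0 b r" for a b r
    by (induction a) (use HV V_def le_trans in \<open>auto\<close>, blast intro: le_trans)
  have mono2: "?D a b r \<le> ?D a 0 r" for a b r
    by (induction b) (use HV H_def le_trans in \<open>auto\<close>, blast intro: le_trans)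
  \<comment> \<open>A nonzero part stays nonzero when moved to either axis, where it is an entry of
    \<open>p\<close>; the two axes bound \<open>b\<close> and \<open>a\<close> respectively, and
    both bound \<open>r\<close>.\<close>
  have "a < L \<and> b < L \<and> r < L" if "?D a b r \<noteq> 0" for a b r
    using that mono1[of a b r] mono2[of a b r] L[of r "r+b"] L[of "r+a" r]
    by (auto simp: diagonals_0_right)
  then show ?thesis unfolding growth_def
    using HV step unfolding V_def H_def by blast
qed

text \<open>The last clause of \<open>growth\<close> determines the outer corner of a unit square
  from the other three.\<close>

lemma growth_eqI:
  assumes D: "growth D" and E: "growth E"
    and "\<And>b r. D 0 b r = E 0 b r" "\<And>a r. D a 0 r = E a 0 r"
  shows "D = E"
proof -
  have "\<forall>b r. D a b r = E a b r" for a
  proof (induction a)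
    case (Suc a)
    have "\<forall>r. D (Suc a) b r = E (Suc a) b r" for b
    proof (induction b)
      case (Suc b)
      show ?case
      proof
        fix r
        show "D (Suc a) (Suc b) r = E (Suc a) (Suc b) r"
          using growthD(5)[OF D, of a b r] growthD(5)[OF E, of a b r] Suc
            \<open>\<forall>b r. D a b r = E a b r\<close> by simp
      qed
    qed (use assms in auto)
    then show ?case by auto
  qed (use assms in auto)
  then show ?thesis by (intro ext) auto
qed

section \<open>Recovering the plane partition from the axes of a diagram\<close>

definition of_diagonals :: "(nat \<Rightarrow> nat \<Rightarrow> nat \<Rightarrow> nat) \<Rightarrow> nat \<Rightarrow> nat \<Rightarrow> nat" where
  "of_diagonals D i j = (if i \<le> j then D 0 (j - i) i else D (i - j) 0 j)"

text \<open>Interlacing of neighbouring diagonals is the same as monotonicity along rows and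
  columns; the three cases are the position relative to the main diagonal.\<close>

lemma plane_partition_of_diagonals:
  assumes "growth D"
  shows "plane_partition (of_diagonals D)"
proof -
  obtain L where L: "\<And>a b r. D a b r \<noteq> 0 \<Longrightarrow> a < L \<and> b < L \<and> r < L"
    using growth_support[OF assms] by blast
  \<comment> \<open>The larger index is a part number plus a diagonal offset, each below
    \<open>L\<close>.\<close>
  have "{(i, j). of_diagonals D i j \<noteq> 0} \<subseteq> {..<2*L} \<times> {..<2*L}"
  proof (rule subrelI)
    fix i j assume "(i, j) \<in> {(i, j). of_diagonals D i j \<noteq> 0}"
    then have "i < 2*L \<and> j < 2*L"
      using L[of 0 "j - i" i] L[of "i - j" 0 j] by (auto simp: of_diagonals_def split: if_splits)
    then show "(i, j) \<in> {..<2*L} \<times> {..<2*L}" by simp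
  qed
  then have "finite {(i, j). of_diagonals D i j \<noteq> 0}"
    by (rule finite_subset) auto
  moreover have "of_diagonals D (Suc i) j \<le> of_diagonals D i j" for i j
  proof -
    consider "Suc i \<le> j" | "i = j" | "j < i" by linarith
    then show ?thesis
    proof cases
      case 1
      then show ?thesis
        using growthD(4)[OF assms, of 0 "j - Suc i" i] Suc_diff_Suc[of i j]
        by (simp add: of_diagonals_def)
    next
      case 2
      then show ?thesis using growthD(1)[OF assms, of 0 0 i]
        by (simp add: of_diagonals_def)
    next
      case 3
      then show ?thesis using growthD(1)[OF assms, of "i - j" 0 j]
        by (simp add: of_diagonals_def Suc_diff_le)
    qed
  qed
  moreover have "of_diagonals D i (Suc j) \<le> of_diagonals D i j" for i j
  proof -
    consider "Suc j < i" | "Suc j = i" | "i \<le> j" by linarith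
    then show ?thesis
    proof cases
      case 1
      then show ?thesis
        using growthD(2)[OF assms, of "i - Suc j" 0 j] Suc_diff_Suc[of j i]
        by (simp add: of_diagonals_def)
    next
      case 2
      then show ?thesis using growthD(2)[OF assms, of 0 0 j]
        by (auto simp add: of_diagonals_def)
    next
      case 3
      then show ?thesis using growthD(3)[OF assms, of 0 "j - i" i]
        by (simp add: of_diagonals_def Suc_diff_le)
    qed
  qed
  ultimately show ?thesis unfolding plane_partition_def by auto
qed

lemma diagonals_of_diagonals:
  assumes "growth D"
  shows "diagonals (of_diagonals D) = D"
  by (rule growth_eqI[OF growth_diagonals[OF plane_partition_of_diagonals[OF assms]] assms])
     (auto simp: diagonals_0_right of_diagonals_def)

lemma of_diagonals_diagonals: "of_diagonals (diagonals p) = p"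
  by (intro ext) (auto simp: of_diagonals_def diagonals_0_right)

text \<open>Far out everything vanishes. Moving towards the origin, the cell yields part 0 at the
  inner corner of a unit square, and the last clause of \<open>growth\<close> solved for
  \<open>D a b (Suc r)\<close> yields the other parts.\<close>

lemma growth_determined_by_cells:
  assumes D: "growth D" and E: "growth E" and eq: "cells D = cells E"
  shows "D = E"
proof -
  obtain L1 where L1: "\<And>a b r. D a b r \<noteq> 0 \<Longrightarrow> a < L1 \<and> b < L1 \<and> r < L1"
    using growth_support[OF D] by blast
  obtain L2 where L2: "\<And>a b r. E a b r \<noteq> 0 \<Longrightarrow> a < L2 \<and> b < L2 \<and> r < L2"
    using growth_support[OF E] by blast
  define L where "L = max L1 L2"
  have zero: "a \<ge> L \<or> b \<ge> L \<Longrightarrow> D a b r = 0 \<and> E a b r = 0" for a b r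
    using L1 L2 unfolding L_def by (metis leD max.boundedE)
  \<comment> \<open>The induction runs over the distance from the far border. Once \<open>i\<close>
    reaches \<open>L\<close> the difference stays 0, so the case \<open>\<not> i < L\<close> repeats
    the previous row.\<close>
  have "\<forall>r. D (L - i) b r = E (L - i) b r" for i b
  proof (induction i arbitrary: b)
    case 0
    then show ?case using zero by auto
  next
    case (Suc i)
    show ?case
    proof (cases "i < L")
      case False
      then have "L - Suc i = L - i" by simp
      then show ?thesis using Suc.IH by simp
    next
      case True
      then have S: "Suc (L - Suc i) = L - i" by simp
      have "\<forall>r. D (L - Suc i) (L - j) r = E (L - Suc i) (L - j) r" for j
      proof (induction j)
        case 0
        then show ?case using zero by auto
      next
        case (Suc j)
        show ?case
        proof (cases "j < L")
          case False
          then have "L - Suc j = L - j" by simp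
          then show ?thesis using Suc.IH by simp
        next
          case True
          then have T: "Suc (L - Suc j) = L - j" by simp
          show ?thesis
          proof
            fix r
            show "D (L - Suc i) (L - Suc j) r = E (L - Suc i) (L - Suc j) r"
            proof (cases r)
              case 0
              have "cells D (L - Suc i) (L - Suc j) = cells E (L - Suc i) (L - Suc j)"
                using eq by simp
              then show ?thesis
                using growth_cells[OF D, of "L - Suc i" "L - Suc j"]
                  growth_cells[OF E, of "L - Suc i" "L - Suc j"]
                unfolding S T using 0 Suc.IH \<open>\<And>b. \<forall>r. D (L - i) b r = E (L - i) b r\<close> by simp
            next
              case (Suc r')
              then show ?thesis
                using growthD(5)[OF D, of "L - Suc i" "L - Suc j" r']
                  growthD(5)[OF E, of "L - Suc i" "L - Suc j" r']
                unfolding S T using Suc.IH \<open>\<And>b. \<forall>r. D (L - i) b r = E (L - i) b r\<close>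
                  \<open>\<forall>r. D (L - Suc i) (L - j) r = E (L - Suc i) (L - j) r\<close> by simp
            qed
          qed
        qed
      qed
      from this[of "L - b"] show ?thesis
        by (cases "b < L") (use zero in auto)
    qed
  qed
  then have "D a b r = E a b r" for a b r
    by (cases "a < L") (use zero in \<open>auto, metis diff_diff_cancel less_imp_le_nat\<close>)
  then show ?thesis by (intro ext)
qed

section \<open>Existence of a diagram with prescribed cells\<close>

context
  fixes N :: "nat \<Rightarrow> nat \<Rightarrow> nat" and L :: nat
begin

text \<open>The growth diagram is built from the far corner inwards: its index \<open>i\<close> stands for the
  coordinate \<open>L - i\<close> of the matrix \<open>N\<close>.\<close>

fun fill :: "nat \<Rightarrow> nat \<Rightarrow> nat \<Rightarrow> nat" where
  "fill 0 j r = 0"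
| "fill (Suc i) 0 r = 0"
| "fill (Suc i) (Suc j) 0 =
     N (L - Suc i) (L - Suc j) + max (fill i (Suc j) 0) (fill (Suc i) j 0)"
| "fill (Suc i) (Suc j) (Suc r) =
     min (fill i (Suc j) r) (fill (Suc i) j r)
     + max (fill i (Suc j) (Suc r)) (fill (Suc i) j (Suc r)) - fill i j r"

lemma fill_0_right [simp]: "fill i 0 r = 0"
  by (cases i) auto

text \<open>The argument of \<open>growth_diagonals\<close> run inwards, with zero borders as
  starting data. Part 0 needs a separate case, since it receives the cell entry on top of the
  maximum.\<close>

lemma fill_interlacing:
  "(\<forall>r. fill i j r \<le> fill (Suc i) j r \<and> fill (Suc i) j (Suc r) \<le> fill i j r) \<and>
   (\<forall>r. fill i j r \<le> fill i (Suc j) r \<and> fill i (Suc j) (Suc r) \<le> fill i j r)"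
proof -
  define V where "V i j \<longleftrightarrow> (\<forall>r. fill i j r \<le> fill (Suc i) j r \<and> fill (Suc i) j (Suc r) \<le> fill i j r)" for i j
  define H where "H i j \<longleftrightarrow> (\<forall>r. fill i j r \<le> fill i (Suc j) r \<and> fill i (Suc j) (Suc r) \<le> fill i j r)" for i j
  have step: "V i (Suc j) \<and> H (Suc i) j" if "V i j" "H i j" for i j
  proof -
    have v: "fill i j r \<le> fill (Suc i) j r" "fill (Suc i) j (Suc r) \<le> fill i j r"
        and h: "fill i j r \<le> fill i (Suc j) r" "fill i (Suc j) (Suc r) \<le> fill i j r" for r
      using that unfolding V_def H_def by auto
    have 1: "max (fill i (Suc j) r) (fill (Suc i) j r) \<le> fill (Suc i) (Suc j) r" for r
    proof (cases r)
      case (Suc r')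
      have "fill i j r' \<le> min (fill i (Suc j) r') (fill (Suc i) j r')" using v h by auto
      then have "max (fill i (Suc j) r) (fill (Suc i) j r) + fill i j r'
          \<le> max (fill i (Suc j) r) (fill (Suc i) j r) + min (fill i (Suc j) r') (fill (Suc i) j r')"
        by (rule add_left_mono)
      then show ?thesis unfolding Suc fill.simps by linarith
    qed simp
    have 2: "fill (Suc i) (Suc j) (Suc r) \<le> min (fill i (Suc j) r) (fill (Suc i) j r)" for r
    proof -
      have "max (fill i (Suc j) (Suc r)) (fill (Suc i) j (Suc r)) \<le> fill i j r" using v h by auto
      from add_left_mono[OF this, of "min (fill i (Suc j) r) (fill (Suc i) j r)"]
      show ?thesis unfolding fill.simps by linarith
    qed
    show ?thesis using 1 2 unfolding V_def H_def by auto
  qed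
  have H0: "H 0 j" and V0: "V j 0" for j
    unfolding H_def V_def by auto
  have "(\<forall>j. H i j) \<and> (\<forall>j. V i j)" for i
  proof (induction i)
    case 0
    have "V 0 b" for b by (induction b) (use V0 H0 step in auto)
    then show ?case using H0 by auto
  next
    case (Suc a)
    then have H: "H (Suc a) b" for b using step by auto
    have "V (Suc a) b" for b by (induction b) (use V0 H step in auto)
    then show ?case using H by auto
  qed
  then show ?thesis unfolding H_def V_def by auto
qed

text \<open>By interlacing each step adds at most one nonzero part; this bounds the support in
  \<open>r\<close>.\<close>

lemma fill_rows: "fill i j r \<noteq> 0 \<Longrightarrow> r < i"
proof (induction i arbitrary: r)
  case (Suc i)
  show ?case
  proof (cases r)
    case (Suc r')
    then have "fill i j r' \<noteq> 0"
      using Suc.prems fill_interlacing[of i j] by (metis le_0_eq)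
    then show ?thesis using Suc.IH Suc by simp
  qed simp
qed simp

end

lemma growth_exists:
  assumes "finite {(a, b). N a b \<noteq> 0}"
  shows "\<exists>D. growth D \<and> cells D = N"
proof -
  obtain L where L: "\<And>i j. N i j \<noteq> 0 \<Longrightarrow> i < L \<and> j < L"
  proof -
    obtain K where K: "fst ` {(i, j). N i j \<noteq> 0} \<union> snd ` {(i, j). N i j \<noteq> 0} \<subseteq> {..<K}"
      using finite_nat_iff_bounded assms by (metis finite_UnI finite_imageI)
    show ?thesis by (rule that[of K]) (use K in force)
  qed
  define D where "D a b r = fill N L (L - a) (L - b) r" for a b r
  note il = fill_interlacing[of N L]
  have supp: "a < L \<and> b < L \<and> r < L" if "D a b r \<noteq> 0" for a b r
  proof -
    have "L - a \<noteq> 0" "L - b \<noteq> 0" using that unfolding D_def by (metis fill.simps(1), metis fill_0_right)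
    moreover have "r < L - a" using that unfolding D_def by (rule fill_rows)
    ultimately show ?thesis by simp
  qed
  have V: "D (Suc a) b r \<le> D a b r \<and> D a b (Suc r) \<le> D (Suc a) b r" for a b r
  proof (cases "a < L")
    case True
    then have "L - a = Suc (L - Suc a)" by simp
    then show ?thesis using il[of "L - Suc a" "L - b"] unfolding D_def by simp
  qed (simp add: D_def)
  have H: "D a (Suc b) r \<le> D a b r \<and> D a b (Suc r) \<le> D a (Suc b) r" for a b r
  proof (cases "b < L")
    case True
    then have "L - b = Suc (L - Suc b)" by simp
    then show ?thesis using il[of "L - a" "L - Suc b"] unfolding D_def by simp
  qed (simp add: D_def)
  have S: "D (Suc a) (Suc b) r + D a b (Suc r) =
      min (D (Suc a) b r) (D a (Suc b) r) + max (D (Suc a) b (Suc r)) (D a (Suc b) (Suc r))" for a b r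
  proof (cases "a < L \<and> b < L")
    case True
    then have *: "L - a = Suc (L - Suc a)" "L - b = Suc (L - Suc b)" by auto
    have "fill N L (L - Suc a) (L - Suc b) r
        \<le> min (fill N L (L - Suc a) (Suc (L - Suc b)) r) (fill N L (Suc (L - Suc a)) (L - Suc b) r)"
      using il by simp
    from trans_le_add1[OF this] show ?thesis
      unfolding D_def * by (simp del: min.bounded_iff)
  next
    case False
    then have "D a b r = 0" "D a b (Suc r) = 0" "D (Suc a) (Suc b) r = 0"
      using supp by (meson Suc_lessD)+
    then show ?thesis using V[of a b] H[of a b] by (metis add_0 le_zero_eq max_def min_def)
  qed
  have C: "cells D a b = N a b" for a b
  proof (cases "a < L \<and> b < L")
    case True
    then have *: "L - a = Suc (L - Suc a)" "L - b = Suc (L - Suc b)" 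
        "L - Suc (L - Suc a) = a" "L - Suc (L - Suc b) = b" by auto
    show ?thesis unfolding cells_def D_def *(1,2) by (simp add: *(3,4))
  next
    case False
    then have "D a b 0 = 0" "N a b = 0" using supp L by metis+
    then show ?thesis unfolding cells_def by simp
  qed
  have "growth D" unfolding growth_def using supp V H S by blast
  then show ?thesis using C by (intro exI[of _ D]) auto
qed

text \<open>Both sides parametrise the same diagrams: plane partitions through the axes, matrices
  through the cells.\<close>

lemma bij_betw_plane_partition_cells:
  "bij_betw (\<lambda>p. cells (diagonals p)) {p. plane_partition p} {N. finite {(a, b). N a b \<noteq> 0}}"
  unfolding bij_betw_def
proof (intro conjI inj_onI set_eqI iffI)
  fix p q assume "p \<in> {p. plane_partition p}" "q \<in> {p. plane_partition p}"
    "cells (diagonals p) = cells (diagonals q)"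
  then have "diagonals p = diagonals q"
    by (intro growth_determined_by_cells) (auto intro: growth_diagonals)
  then show "p = q" by (metis of_diagonals_diagonals)
next
  fix N assume "N \<in> (\<lambda>p. cells (diagonals p)) ` {p. plane_partition p}"
  then obtain p where p: "plane_partition p" "N = cells (diagonals p)" by auto
  obtain L where L: "\<And>a b r. diagonals p a b r \<noteq> 0 \<Longrightarrow> a < L \<and> b < L \<and> r < L"
    using growth_support[OF growth_diagonals[OF p(1)]] by blast
  have "{(a, b). N a b \<noteq> 0} \<subseteq> {..<L} \<times> {..<L}"
  proof (rule subrelI)
    fix a b assume "(a, b) \<in> {(a, b). N a b \<noteq> 0}"
    then have "diagonals p a b 0 \<noteq> 0" by (auto simp: p(2) cells_def)
    then show "(a, b) \<in> {..<L} \<times> {..<L}" using L by auto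
  qed
  then show "N \<in> {N. finite {(a, b). N a b \<noteq> 0}}" by (auto intro: finite_subset)
next
  fix N :: "nat \<Rightarrow> nat \<Rightarrow> nat" assume "N \<in> {N. finite {(a, b). N a b \<noteq> 0}}"
  then obtain D where "growth D" "cells D = N" using growth_exists by blast
  then show "N \<in> (\<lambda>p. cells (diagonals p)) ` {p. plane_partition p}"
    using diagonals_of_diagonals plane_partition_of_diagonals by (metis (mono_tags, lifting) image_eqI mem_Collect_eq)
qed

text \<open>Since min plus max is the plain sum, adding the local rule over all parts leaves
  inclusion-exclusion for the part sums \<open>S\<close>, with the cell as the only defect. Solving
  that recursion from the far corner gives the sum over a quadrant.\<close>

lemma growth_row_sum:
  assumes D: "growth D" and L: "\<forall>a b r. D a b r \<noteq> 0 \<longrightarrow> a < L \<and> b < L \<and> r < L"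
  shows "(\<Sum>r<L. D a b r) = (\<Sum>a'\<in>{a..<L}. \<Sum>b'\<in>{b..<L}. cells D a' b')"
proof -
  define S where "S a b = (\<Sum>r<L. D a b r)" for a b
  have Z: "D a b r = 0" if "a \<ge> L \<or> b \<ge> L \<or> r \<ge> L" for a b r
    using L[rule_format, of a b r] that by (cases "D a b r = 0") auto
  have rec: "S (Suc a) (Suc b) + S a b = cells D a b + S (Suc a) b + S a (Suc b)" for a b
  proof -
    \<comment> \<open>Valid without a boundary term because part \<open>L\<close> is already
      zero.\<close>
    have shift: "(\<Sum>r<L. f (Suc r)) + f 0 = (\<Sum>r<L. f r)" if "f L = 0" for f :: "nat \<Rightarrow> nat"
      using sum.lessThan_Suc_shift[of f L] that by simp
    let ?mx = "\<lambda>r. max (D (Suc a) b r) (D a (Suc b) r)"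
    let ?mn = "\<lambda>r. min (D (Suc a) b r) (D a (Suc b) r)"
    have "S (Suc a) (Suc b) + S a b = (\<Sum>r<L. D (Suc a) (Suc b) r) + ((\<Sum>r<L. D a b (Suc r)) + D a b 0)"
      unfolding S_def using shift[of "D a b"] Z by simp
    also have "\<dots> = (\<Sum>r<L. D (Suc a) (Suc b) r + D a b (Suc r)) + D a b 0"
      by (simp add: sum.distrib)
    also have "\<dots> = (\<Sum>r<L. ?mn r + ?mx (Suc r)) + D a b 0"
      using growthD(5)[OF D] by simp
    also have "\<dots> = cells D a b + ((\<Sum>r<L. ?mn r) + ((\<Sum>r<L. ?mx (Suc r)) + ?mx 0))"
      unfolding growth_cells[OF D, of a b] by (simp add: sum.distrib)
    also have "(\<Sum>r<L. ?mx (Suc r)) + ?mx 0 = (\<Sum>r<L. ?mx r)"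
      using shift[of ?mx] Z by simp
    also have "(\<Sum>r<L. ?mn r) + (\<Sum>r<L. ?mx r) = S (Suc a) b + S a (Suc b)"
      unfolding S_def sum.distrib[symmetric] by (intro sum.cong) auto
    finally show ?thesis by simp
  qed
  \<comment> \<open>First telescoping, along \<open>b\<close>; the one along \<open>a\<close>
    follows below.\<close>
  have diff: "S a b = S (Suc a) b + (\<Sum>b'\<in>{b..<L}. cells D a b')" for a b
  proof (cases "b \<le> L")
    case True
    then show ?thesis
    proof (induction b rule: inc_induct)
      case base
      then show ?case using Z by (simp add: S_def)
    next
      case (step b)
      then show ?case using rec[of a b] by (simp add: sum.atLeast_Suc_lessThan)
    qed
  qed (use Z in \<open>simp add: S_def\<close>)
  have "S a b = (\<Sum>a'\<in>{a..<L}. \<Sum>b'\<in>{b..<L}. cells D a' b')"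
  proof (cases "a \<le> L")
    case True
    then show ?thesis
    proof (induction a rule: inc_induct)
      case base
      then show ?case using Z by (simp add: S_def)
    next
      case (step a)
      then show ?case using diff[of a b] by (simp add: sum.atLeast_Suc_lessThan)
    qed
  qed (use Z in \<open>simp add: S_def\<close>)
  then show ?thesis by (simp add: S_def)
qed

text \<open>The value \<open>f b'\<close> occurs once for every \<open>b\<close> from 1 to
  \<open>b'\<close>.\<close>

lemma sum_tail_sums:
  fixes f :: "nat \<Rightarrow> nat"
  shows "(\<Sum>b\<in>{1..<L}. \<Sum>b'\<in>{b..<L}. f b') = (\<Sum>b<L. b * f b)"
proof (induction L)
  case (Suc L)
  have "(\<Sum>b\<in>{1..<Suc L}. \<Sum>b'\<in>{b..<Suc L}. f b') = (\<Sum>b\<in>{1..<Suc L}. (\<Sum>b'\<in>{b..<L}. f b') + f L)"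
    by (intro sum.cong) auto
  also have "\<dots> = (\<Sum>b\<in>{1..<Suc L}. \<Sum>b'\<in>{b..<L}. f b') + L * f L"
    by (simp add: sum.distrib)
  also have "(\<Sum>b\<in>{1..<Suc L}. \<Sum>b'\<in>{b..<L}. f b') = (\<Sum>b\<in>{1..<L}. \<Sum>b'\<in>{b..<L}. f b')"
    by (cases "L = 0") (auto simp: sum.atLeastLessThan_Suc)
  finally show ?case using Suc by simp
qed simp

text \<open>Each diagonal of \<open>p\<close> sums to the entries of \<open>N\<close> in a quadrant
  with corner on an axis. Adding over the offsets 1, 2, ... counts an entry as often as its column
  (or row) index; offset 0 gives the trace.\<close>

lemma statistics_eq_cells:
  assumes p: "plane_partition p"
    and L: "\<forall>a b r. diagonals p a b r \<noteq> 0 \<longrightarrow> a < L \<and> b < L \<and> r < L"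
  defines "N \<equiv> cells (diagonals p)"
  shows "w_plus p = (\<Sum>a<L. \<Sum>b<L. b * N a b)"
    and "w_minus p = (\<Sum>a<L. \<Sum>b<L. a * N a b)"
    and "w_zero p = (\<Sum>a<L. \<Sum>b<L. N a b)"
    and "pp_size p = (\<Sum>a<L. \<Sum>b<L. (a + b + 1) * N a b)"
proof -
  have supp: "i < L \<and> j - i < L" if "p i j > 0" "i \<le> j" for i j
    using L[rule_format, of 0 "j - i" i] that by simp
  have supp': "j < L \<and> i - j < L" if "p i j > 0" "j \<le> i" for i j
    using L[rule_format, of "i - j" 0 j] that by (simp add: diagonals_0_right)
  have fin_box: "finite {(x, y). Suc 0 \<le> x \<and> x < L \<and> y < L \<and> P x y}" for P
    by (rule finite_subset[of _ "{..<L} \<times> {..<L}"]) auto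
  have fin: "finite (pp_support p)"
    using p unfolding plane_partition_def pp_support_def by simp
  have row: "(\<Sum>r<L. diagonals p a b r) = (\<Sum>a'\<in>{a..<L}. \<Sum>b'\<in>{b..<L}. N a' b')" for a b
    unfolding N_def by (rule growth_row_sum[OF growth_diagonals[OF p]]) (rule L)
  \<comment> \<open>The entry \<open>(i, j)\<close> above the main diagonal is part \<open>i\<close>
    of the diagonal with offset \<open>j - i\<close>. \<open>T'\<close> collects the positions of
    the box outside the support, which contribute 0.\<close>
  have "w_plus p = (\<Sum>(b, r)\<in>{1..<L} \<times> {..<L}. diagonals p 0 b r)"
    unfolding w_plus_def
    by (rule sum.reindex_bij_witness_not_neutral[where S' = "{}" and j = "\<lambda>(i, j). (j - i, i)"
          and T' = "{(b, r) \<in> {1..<L} \<times> {..<L}. p r (r + b) = 0}" and i = "\<lambda>(b, r). (r, r + b)"])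
       (use supp in \<open>auto simp: pp_support_def intro: fin_box\<close>)
  also have "\<dots> = (\<Sum>b\<in>{1..<L}. \<Sum>a<L. \<Sum>b'\<in>{b..<L}. N a b')"
    unfolding sum.cartesian_product[symmetric] row by (simp only: atLeast0LessThan)
  also have "\<dots> = (\<Sum>a<L. \<Sum>b\<in>{1..<L}. \<Sum>b'\<in>{b..<L}. N a b')"
    by (rule sum.swap)
  finally show 1: "w_plus p = (\<Sum>a<L. \<Sum>b<L. b * N a b)"
    by (simp only: sum_tail_sums)
  have "w_minus p = (\<Sum>(a, r)\<in>{1..<L} \<times> {..<L}. diagonals p a 0 r)"
    unfolding w_minus_def
    by (rule sum.reindex_bij_witness_not_neutral[where S' = "{}" and j = "\<lambda>(i, j). (i - j, j)"
          and T' = "{(a, r) \<in> {1..<L} \<times> {..<L}. p (r + a) r = 0}" and i = "\<lambda>(a, r). (r + a, r)"])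
       (use supp' in \<open>auto simp: pp_support_def diagonals_0_right intro: fin_box\<close>)
  also have "\<dots> = (\<Sum>a\<in>{1..<L}. \<Sum>a'\<in>{a..<L}. \<Sum>b<L. N a' b)"
    unfolding sum.cartesian_product[symmetric] row by (simp only: atLeast0LessThan)
  also have "\<dots> = (\<Sum>a<L. a * (\<Sum>b<L. N a b))"
    by (rule sum_tail_sums)
  finally show 2: "w_minus p = (\<Sum>a<L. \<Sum>b<L. a * N a b)"
    by (simp only: sum_distrib_left)
  have "w_zero p = (\<Sum>r<L. diagonals p 0 0 r)"
    unfolding w_zero_def
    by (rule sum.reindex_bij_witness_not_neutral[where S' = "{}" and j = fst
          and T' = "{r \<in> {..<L}. p r r = 0}" and i = "\<lambda>r. (r, r)"])
       (use supp in \<open>auto simp: pp_support_def\<close>)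
  then show 3: "w_zero p = (\<Sum>a<L. \<Sum>b<L. N a b)"
    unfolding row by (simp only: atLeast0LessThan)
  have "pp_support p = {(i, j)\<in>pp_support p. i < j} \<union> ({(i, j)\<in>pp_support p. i > j} \<union> {(i, j)\<in>pp_support p. i = j})"
    by auto
  then have "pp_size p = (\<Sum>(i, j)\<in>{(i, j)\<in>pp_support p. i < j} \<union> ({(i, j)\<in>pp_support p. i > j} \<union> {(i, j)\<in>pp_support p. i = j}). p i j)"
    unfolding pp_size_def by simp
  also have "\<dots> = w_plus p + (w_minus p + w_zero p)"
    unfolding w_plus_def w_minus_def w_zero_def
    by (subst sum.union_disjoint; (subst sum.union_disjoint)?)
       (auto intro: finite_subset[OF _ fin])
  finally show "pp_size p = (\<Sum>a<L. \<Sum>b<L. (a + b + 1) * N a b)"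
    unfolding 1 2 3 by (simp add: sum.distrib[symmetric] algebra_simps)
qed

section \<open>Generating function and coefficient integral\<close>

definition weighted_configs :: "('a \<Rightarrow> nat) \<Rightarrow> 'a set \<Rightarrow> nat \<Rightarrow> ('a \<Rightarrow> nat) set" where
  "weighted_configs m A n = {N \<in> A \<rightarrow>\<^sub>E UNIV. (\<Sum>x\<in>A. m x * N x) = n}"

lemma finite_weighted_configs:
  assumes "finite A" "\<And>x. x \<in> A \<Longrightarrow> m x > 0"
  shows "finite (weighted_configs m A n)"
proof (rule finite_subset)
  show "weighted_configs m A n \<subseteq> A \<rightarrow>\<^sub>E {..n}"
  proof
    fix N assume N: "N \<in> weighted_configs m A n"
    have "N x \<le> n" if "x \<in> A" for x
    proof -
      have "N x \<le> m x * N x" using assms(2)[OF that] by simp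
      also have "\<dots> \<le> (\<Sum>x\<in>A. m x * N x)" using assms(1) that by (intro member_le_sum) auto
      finally show ?thesis using N by (simp add: weighted_configs_def)
    qed
    then show "N \<in> A \<rightarrow>\<^sub>E {..n}" using N by (auto simp: weighted_configs_def PiE_iff)
  qed
  show "finite (A \<rightarrow>\<^sub>E {..n})" using assms(1) by (intro finite_PiE) auto
qed

text \<open>Every factor is a geometric series; the expanded product is regrouped by total weight,
  and absolute convergence permits this.\<close>

lemma sums_weighted_configs:
  fixes w :: "'a \<Rightarrow> 'b::{banach, real_normed_field}" and z :: 'b
  assumes A: "finite A" "\<And>x. x \<in> A \<Longrightarrow> m x > 0"
    and w: "\<And>x. x \<in> A \<Longrightarrow> norm (w x) \<le> 1" and z: "norm z < 1"
  shows "(\<lambda>n. (\<Sum>N\<in>weighted_configs m A n. \<Prod>x\<in>A. w x ^ N x) * z ^ n) sums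
     (\<Prod>x\<in>A. 1 / (1 - w x * z ^ m x))"
proof -
  let ?v = "\<lambda>x. w x * z ^ m x"
  have v: "norm (?v x) < 1" if "x \<in> A" for x
  proof -
    have "norm (?v x) \<le> 1 * norm z ^ m x"
      unfolding norm_mult norm_power using w[OF that] by (intro mult_right_mono) auto
    also have "\<dots> < 1" using z A(2)[OF that] by (simp add: power_less_one_iff)
    finally show ?thesis .
  qed
  have geo: "((\<lambda>k. ?v x ^ k) has_sum (1 / (1 - ?v x))) UNIV" if "x \<in> A" for x
    using v[OF that] by (intro norm_summable_imp_has_sum geometric_sums)
      (auto simp: norm_power intro!: summable_geometric)
  have "infsum (\<lambda>N. \<Prod>x\<in>A. ?v x ^ N x) (A \<rightarrow>\<^sub>E UNIV) = (\<Prod>x\<in>A. infsum (\<lambda>k. ?v x ^ k) UNIV)"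
    using A(1)
  proof (rule infsum_prod_PiE_abs)
    fix x assume "x \<in> A"
    then show "(\<lambda>k. ?v x ^ k) abs_summable_on UNIV"
      using v[of x] by (intro norm_summable_imp_summable_on)
        (auto simp: norm_power norm_mult intro!: summable_geometric)
  qed
  also have "\<dots> = (\<Prod>x\<in>A. 1 / (1 - ?v x))"
    using geo by (intro prod.cong infsumI) auto
  finally have inf: "infsum (\<lambda>N. \<Prod>x\<in>A. ?v x ^ N x) (A \<rightarrow>\<^sub>E UNIV) = (\<Prod>x\<in>A. 1 / (1 - ?v x))" .
  \<comment> \<open>Gives summability of the expanded family: \<open>infsum\<close> of a family that
    is not summable is 0, whereas here it equals a nonzero product.\<close>
  have "(\<Prod>x\<in>A. 1 / (1 - ?v x)) \<noteq> 0"
  proof -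
    have "1 / (1 - ?v x) \<noteq> 0" if "x \<in> A" for x
    proof -
      have "?v x \<noteq> 1"
      proof
        assume eq: "?v x = 1"
        show False using v[OF that] unfolding eq by simp
      qed
      then show ?thesis by simp
    qed
    then show ?thesis unfolding prod_zero_iff[OF A(1)] by blast
  qed
  then have "(\<lambda>N. \<Prod>x\<in>A. ?v x ^ N x) summable_on (A \<rightarrow>\<^sub>E UNIV)"
    unfolding inf[symmetric] by (rule contrapos_np) (rule infsum_not_exists)
  from has_sum_infsum[OF this] have *: "((\<lambda>N. \<Prod>x\<in>A. ?v x ^ N x) has_sum (\<Prod>x\<in>A. 1 / (1 - ?v x))) (A \<rightarrow>\<^sub>E UNIV)"
    unfolding inf .
  have "((\<lambda>(n, N). \<Prod>x\<in>A. ?v x ^ N x) has_sum (\<Prod>x\<in>A. 1 / (1 - ?v x)))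
      (Sigma UNIV (weighted_configs m A))"
    using * by (rule has_sum_reindex_bij_witness[where i = "\<lambda>N. (\<Sum>x\<in>A. m x * N x, N)" and j = snd, THEN iffD2, rotated -1])
      (auto simp: weighted_configs_def)
  then have "((\<lambda>n. \<Sum>N\<in>weighted_configs m A n. \<Prod>x\<in>A. ?v x ^ N x) has_sum (\<Prod>x\<in>A. 1 / (1 - ?v x))) UNIV"
    by (rule has_sum_SigmaD) (simp add: finite_weighted_configs[OF A])
  then have "(\<lambda>n. \<Sum>N\<in>weighted_configs m A n. \<Prod>x\<in>A. ?v x ^ N x) sums (\<Prod>x\<in>A. 1 / (1 - ?v x))"
    by (rule has_sum_imp_sums)
  moreover have "(\<Prod>x\<in>A. ?v x ^ N x) = (\<Prod>x\<in>A. w x ^ N x) * z ^ n" if "N \<in> weighted_configs m A n" for n N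
    using that by (auto simp: weighted_configs_def power_mult_distrib prod.distrib power_mult power_sum)
  ultimately show ?thesis by (simp add: sum_distrib_right)
qed

lemma integral_iexp_full_period:
  fixes j :: int
  shows "(LINT x|lborel. indicator {-pi..pi} x *\<^sub>R cis (of_int j * x)) = (if j = 0 then 2 * pi else 0)"
proof (cases "j = 0")
  case True
  have "(LINT x|lborel. indicator {-pi..pi} x *\<^sub>R cis (of_int j * x)) = (LINT x|lborel. indicator {-pi..pi} x *\<^sub>R (1::complex))"
    using True by simp
  then show ?thesis using True by (simp add: scaleR_conv_of_real)
next
  case False
  define F where "F x = cis (of_int j * x) / (\<i> * of_int j)" for x
  have "(F has_vector_derivative cis (of_int j * x)) (at x within {-pi..pi})" for x
    unfolding F_def cis_conv_exp using False
    by (auto intro!: derivative_eq_intros has_vector_derivative_real_field simp: field_simps)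
  then have "(LINT x|lborel. indicator {-pi..pi} x *\<^sub>R cis (of_int j * x)) = F pi - F (-pi)"
    by (intro integral_FTC_atLeastAtMost) (auto intro!: continuous_intros)
  also have "F pi - F (-pi) = 0"
  proof -
    have "sin (of_int j * pi) = 0" by (metis sin_zero_iff_int2)
    then have "cis (of_int j * pi) = cis (of_int j * (-pi))"
      by (simp add: complex_eq_iff)
    then show ?thesis unfolding F_def by (simp only: diff_self)
  qed
  finally show ?thesis using False by simp
qed

text \<open>Orthogonality of the characters; absolute convergence at radius \<open>q\<close> allows
  termwise integration.\<close>

lemma integral_power_series_coefficient:
  fixes c :: "nat \<Rightarrow> complex" and q :: real
  assumes c: "summable (\<lambda>k. norm (c k) * q ^ k)" and q: "q \<ge> 0"
  shows "(LINT x|lborel. indicator {-pi..pi} x *\<^sub>R (cis (- real n * x) * (\<Sum>k. c k * (of_real q * cis x) ^ k)))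
     = 2 * pi * c n * q ^ n"
proof -
  define f where "f k x = indicator {-pi..pi} x *\<^sub>R (c k * q ^ k * cis (of_int (int k - int n) * x))" for k and x :: real
  have nf: "norm (f k x) = indicator {-pi..pi} x * (norm (c k) * q ^ k)" for k x
    using q by (auto simp: f_def norm_mult norm_power indicator_def)
  have int: "integrable lborel (f k)" for k
    unfolding f_def by (intro borel_integrable_compact continuous_intros) auto
  have "(\<lambda>k. integral\<^sup>L lborel (f k)) sums (LINT x|lborel. (\<Sum>k. f k x))"
  proof (rule sums_integral[OF int])
    show "AE x in lborel. summable (\<lambda>k. norm (f k x))"
      unfolding nf using c by (intro AE_I2 summable_mult)
    show "summable (\<lambda>k. LINT x|lborel. norm (f k x))"
      unfolding nf using c by (simp add: summable_mult)
  qed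
  moreover have "integral\<^sup>L lborel (f k) = (if k = n then 2 * pi * c n * q ^ n else 0)" for k
  proof -
    have "integral\<^sup>L lborel (f k) = (LINT x|lborel. c k * q ^ k * (indicator {-pi..pi} x *\<^sub>R cis (of_int (int k - int n) * x)))"
      unfolding f_def by (intro Bochner_Integration.integral_cong) auto
    also have "\<dots> = c k * q ^ k * (if int k - int n = 0 then 2 * pi else 0)"
      unfolding integral_mult_right_zero integral_iexp_full_period ..
    finally show ?thesis by simp
  qed
  ultimately have "(\<lambda>k. if k = n then 2 * pi * c n * q ^ n else 0) sums (LINT x|lborel. (\<Sum>k. f k x))"
    by simp
  then have "(LINT x|lborel. (\<Sum>k. f k x)) = 2 * pi * c n * q ^ n"
    by (rule sums_unique2) (rule sums_single)
  moreover have "(\<Sum>k. f k x) = indicator {-pi..pi} x *\<^sub>R (cis (- real n * x) * (\<Sum>k. c k * (of_real q * cis x) ^ k))" for x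
  proof -
    have 1: "c k * q ^ k * cis (of_int (int k - int n) * x) = cis (- real n * x) * (c k * (of_real q * cis x) ^ k)" for k
    proof -
      have "cis (of_int (int k - int n) * x) = cis (- real n * x) * cis (real k * x)"
        by (simp add: cis_mult left_diff_distrib)
      then show ?thesis by (simp add: power_mult_distrib Complex.DeMoivre)
    qed
    have "norm (c k * (of_real q * cis x) ^ k) = norm (c k) * q ^ k" for k
      using q by (simp add: norm_mult norm_power)
    then have "summable (\<lambda>k. c k * (of_real q * cis x) ^ k)"
      using c by - (rule summable_norm_cancel, simp)
    then show ?thesis unfolding f_def 1
      by (simp only: suminf_scaleR_right[OF summable_mult, symmetric] suminf_mult)
  qed
  ultimately show ?thesis by simp
qed

lemma prod_cis: "(\<Prod>x\<in>A. cis (f x)) = cis (\<Sum>x\<in>A. f x)"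
  by (induction A rule: infinite_finite_induct) (auto simp: cis_mult)

lemma integral_weighted_configs:
  fixes \<alpha> :: "'a \<Rightarrow> real" and q :: real
  assumes A: "finite A" "\<And>x. x \<in> A \<Longrightarrow> m x > 0" and q: "0 \<le> q" "q < 1"
  shows "(LINT t|lborel. indicator {-pi..pi} t *\<^sub>R
            (cis (- real n * t) * (\<Prod>x\<in>A. 1 / (1 - cis (\<alpha> x) * (of_real q * cis t) ^ m x))))
       = 2 * pi * (\<Sum>N\<in>weighted_configs m A n. cis (\<Sum>x\<in>A. \<alpha> x * real (N x))) * q ^ n"
proof -
  define c where "c k = (\<Sum>N\<in>weighted_configs m A k. cis (\<Sum>x\<in>A. \<alpha> x * real (N x)))" for k
  have c_alt: "c k = (\<Sum>N\<in>weighted_configs m A k. \<Prod>x\<in>A. cis (\<alpha> x) ^ N x)" for k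
    unfolding c_def Complex.DeMoivre prod_cis by (simp add: mult.commute)
  \<comment> \<open>The twists have modulus 1, so the untwisted generating function, which converges
    at \<open>q\<close>, majorises the coefficients.\<close>
  have c_le: "norm (c k) \<le> real (card (weighted_configs m A k))" for k
    unfolding c_def by (rule order_trans[OF norm_sum]) simp
  have "summable (\<lambda>k. real (card (weighted_configs m A k)) * q ^ k)"
    using sums_summable[OF sums_weighted_configs[OF A, where w = "\<lambda>_. 1" and z = q]] q by simp
  then have "summable (\<lambda>k. norm (c k) * q ^ k)"
  proof (rule summable_comparison_test'[where N = 0])
    fix k
    show "norm (norm (c k) * q ^ k) \<le> real (card (weighted_configs m A k)) * q ^ k"
      using mult_right_mono[OF c_le[of k], of "q ^ k"] q(1) by (simp add: norm_mult norm_power)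
  qed
  note * = integral_power_series_coefficient[OF this q(1), of n]
  have "(\<Sum>k. c k * (of_real q * cis t) ^ k) = (\<Prod>x\<in>A. 1 / (1 - cis (\<alpha> x) * (of_real q * cis t) ^ m x))" for t
    unfolding c_alt
    by (rule sums_unique[symmetric], rule sums_weighted_configs[OF A]) (use q in \<open>simp_all add: norm_mult\<close>)
  with * show ?thesis unfolding c_def by simp
qed

section \<open>Specialisation to plane partitions\<close>

definition cell_weight :: "nat \<times> nat \<Rightarrow> nat" where
  "cell_weight = (\<lambda>(a, b). a + b + 1)"

text \<open>What one unit in the cell \<open>(a, b)\<close> adds to \<open>pp_stat\<close>.\<close>

definition cell_shift :: "real \<Rightarrow> nat \<times> nat \<Rightarrow> real" where
  "cell_shift \<delta> = (\<lambda>(a, b). \<delta> + real b - real a)"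

definition pp_stat :: "real \<Rightarrow> (nat \<Rightarrow> nat \<Rightarrow> nat) \<Rightarrow> real" where
  "pp_stat \<delta> p = \<delta> * real (w_zero p) + real (w_plus p) - real (w_minus p)"

abbreviation square :: "nat \<Rightarrow> (nat \<times> nat) set" where
  "square L \<equiv> {..<L} \<times> {..<L}"

text \<open>A nonzero cell has weight at most \<open>n\<close>, hence both coordinates below
  \<open>n\<close>. The support bound depending on \<open>p\<close> can thus be traded for a square
  depending on \<open>n\<close> alone.\<close>

lemma plane_partition_config:
  assumes p: "p \<in> plane_partitions n" and L: "n \<le> L"
  defines "N \<equiv> \<lambda>x. cells (diagonals p) (fst x) (snd x)"
  shows "\<And>x. N x \<noteq> 0 \<Longrightarrow> x \<in> square L"
    and "(\<Sum>x\<in>square L. cell_weight x * N x) = n"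
    and "(\<Sum>x\<in>square L. cell_shift \<delta> x * real (N x)) = pp_stat \<delta> p"
proof -
  have pp: "plane_partition p" and size: "pp_size p = n"
    using p by (auto simp: plane_partitions_def)
  obtain K where K: "\<forall>a b r. diagonals p a b r \<noteq> 0 \<longrightarrow> a < K \<and> b < K \<and> r < K"
    using growth_support[OF growth_diagonals[OF pp]] by blast
  note st = statistics_eq_cells[OF pp K]
  have suppK: "x \<in> square K" if "N x \<noteq> 0" for x
    using that K[rule_format, of "fst x" "snd x" 0] by (cases x) (auto simp: N_def cells_def)
  have "pp_size p = (\<Sum>a<K. \<Sum>b<K. (a + b + 1) * N (a, b))"
    using st(4) by (simp add: N_def)
  then have sz: "(\<Sum>x\<in>square K. cell_weight x * N x) = n"
    unfolding size by (simp add: sum.cartesian_product cell_weight_def case_prod_unfold)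
  show suppL: "x \<in> square L" if "N x \<noteq> 0" for x
  proof -
    have "cell_weight x \<le> cell_weight x * N x" using that by simp
    also have "\<dots> \<le> (\<Sum>x\<in>square K. cell_weight x * N x)"
      using suppK[OF that] by (intro member_le_sum) auto
    finally show ?thesis using L sz by (cases x) (auto simp: cell_weight_def)
  qed
  have change: "(\<Sum>x\<in>square L. f x) = (\<Sum>x\<in>square K. f x)" if "\<And>x. N x = 0 \<Longrightarrow> f x = 0" for f :: "nat \<times> nat \<Rightarrow> 'z::comm_monoid_add"
    by (rule sum.mono_neutral_cong) (use suppK suppL that in \<open>blast+\<close>)
  show "(\<Sum>x\<in>square L. cell_weight x * N x) = n"
    using sz by (subst change) auto
  have "pp_stat \<delta> p = (\<Sum>a<K. \<Sum>b<K. \<delta> * real (N (a, b)) + real b * real (N (a, b)) - real a * real (N (a, b)))"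
    unfolding pp_stat_def st by (simp add: N_def sum.distrib sum_subtractf sum_distrib_left)
  also have "\<dots> = (\<Sum>x\<in>square K. cell_shift \<delta> x * real (N x))"
    by (simp add: sum.cartesian_product cell_shift_def case_prod_unfold algebra_simps)
  finally show "(\<Sum>x\<in>square L. cell_shift \<delta> x * real (N x)) = pp_stat \<delta> p"
    by (subst change) auto
qed

lemma bij_betw_plane_partitions_configs:
  assumes L: "n \<le> L"
  shows "bij_betw (\<lambda>p. \<lambda>x\<in>square L. cells (diagonals p) (fst x) (snd x))
     (plane_partitions n) (weighted_configs cell_weight (square L) n)"
  unfolding bij_betw_def
proof (intro conjI inj_onI set_eqI iffI)
  fix p p' assume p: "p \<in> plane_partitions n" and p': "p' \<in> plane_partitions n"
    and eq: "(\<lambda>x\<in>square L. cells (diagonals p) (fst x) (snd x)) = (\<lambda>x\<in>square L. cells (diagonals p') (fst x) (snd x))"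
  have "cells (diagonals p) a b = cells (diagonals p') a b" for a b
  proof (cases "(a, b) \<in> square L")
    case True
    then show ?thesis using fun_cong[OF eq, of "(a, b)"] by simp
  next
    case False
    then have "cells (diagonals p) a b = 0" "cells (diagonals p') a b = 0"
      using plane_partition_config(1)[OF p L, of "(a, b)"] plane_partition_config(1)[OF p' L, of "(a, b)"]
      by (metis fst_conv snd_conv)+
    then show ?thesis by simp
  qed
  then have "cells (diagonals p) = cells (diagonals p')" by (intro ext)
  then show "p = p'"
    using bij_betw_imp_inj_on[OF bij_betw_plane_partition_cells] p p'
    by (auto simp: plane_partitions_def inj_on_def)
next
  fix N assume "N \<in> (\<lambda>p. \<lambda>x\<in>square L. cells (diagonals p) (fst x) (snd x)) ` plane_partitions n"
  then obtain p where p: "p \<in> plane_partitions n"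
    and N: "N = (\<lambda>x\<in>square L. cells (diagonals p) (fst x) (snd x))" by blast
  have "(\<Sum>x\<in>square L. cell_weight x * N x) = n"
    unfolding plane_partition_config(2)[OF p L, symmetric] N by (intro sum.cong) simp_all
  then show "N \<in> weighted_configs cell_weight (square L) n"
    unfolding weighted_configs_def by (simp add: N)
next
  fix N assume N: "N \<in> weighted_configs cell_weight (square L) n"
  \<comment> \<open>\<open>N\<close> is \<open>undefined\<close> off the square; a genuine finitely
    supported matrix needs 0 there.\<close>
  define M where "M a b = (if (a, b) \<in> square L then N (a, b) else 0)" for a b
  have "finite {(a, b). M a b \<noteq> 0}"
    by (rule finite_subset[of _ "square L"]) (auto simp: M_def split: if_splits)
  then have "M \<in> (\<lambda>p. cells (diagonals p)) ` {p. plane_partition p}"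
    using bij_betw_imp_surj_on[OF bij_betw_plane_partition_cells] by auto
  then obtain p where p: "plane_partition p" "cells (diagonals p) = M" by auto
  have NM: "(\<lambda>x\<in>square L. cells (diagonals p) (fst x) (snd x)) = N"
    using N by (auto simp: p M_def weighted_configs_def PiE_iff extensional_def fun_eq_iff)
  have "p \<in> plane_partitions (pp_size p)" using p by (simp add: plane_partitions_def)
  note pc = plane_partition_config[OF this, of "max L (pp_size p)", unfolded p]
  have "pp_size p = (\<Sum>x\<in>square (max L (pp_size p)). cell_weight x * M (fst x) (snd x))"
    using pc(2) by simp
  also have "\<dots> = (\<Sum>x\<in>square L. cell_weight x * N x)"
    by (rule sum.mono_neutral_cong_right) (auto simp: M_def)
  also have "\<dots> = n" using N by (simp add: weighted_configs_def)
  finally have "p \<in> plane_partitions n" using p by (simp add: plane_partitions_def)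
  then show "N \<in> (\<lambda>p. \<lambda>x\<in>square L. cells (diagonals p) (fst x) (snd x)) ` plane_partitions n"
    using NM by blast
qed

lemma sum_plane_partitions_eq_configs:
  assumes L: "n \<le> L"
  shows "(\<Sum>p\<in>plane_partitions n. g (pp_stat \<delta> p)) =
    (\<Sum>N\<in>weighted_configs cell_weight (square L) n. g (\<Sum>x\<in>square L. cell_shift \<delta> x * real (N x)))"
proof -
  have "(\<Sum>N\<in>weighted_configs cell_weight (square L) n. g (\<Sum>x\<in>square L. cell_shift \<delta> x * real (N x))) =
     (\<Sum>p\<in>plane_partitions n. g (\<Sum>x\<in>square L. cell_shift \<delta> x * real ((\<lambda>x\<in>square L. cells (diagonals p) (fst x) (snd x)) x)))"
    by (rule sum.reindex_bij_betw[OF bij_betw_plane_partitions_configs[OF L], symmetric])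
  also have "\<dots> = (\<Sum>p\<in>plane_partitions n. g (pp_stat \<delta> p))"
    by (intro sum.cong refl) (simp add: plane_partition_config(3)[OF _ L, symmetric])
  finally show ?thesis ..
qed

lemma finite_plane_partitions: "finite (plane_partitions n)"
  using bij_betw_finite[OF bij_betw_plane_partitions_configs[OF order_refl]]
    finite_weighted_configs[of "square n" cell_weight n] by (auto simp: cell_weight_def)

lemma plane_partitions_nonempty: "plane_partitions n \<noteq> {}"
proof -
  define p where "p i j = (if i = 0 \<and> j = 0 then n else 0)" for i j :: nat
  have s: "pp_support p = (if n = 0 then {} else {(0, 0)})"
    by (auto simp: pp_support_def p_def split: if_splits)
  then have "pp_size p = n" by (simp add: pp_size_def p_def)
  moreover have "finite {(i, j). p i j \<noteq> 0}"
    using s unfolding pp_support_def by simp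
  then have "plane_partition p"
    by (auto simp: plane_partition_def p_def)
  ultimately show ?thesis by (auto simp: plane_partitions_def)
qed

text \<open>Cells outside the square weigh more than \<open>n\<close> and cannot affect the
  coefficient, so the finite product is exact as soon as \<open>L\<close> reaches
  \<open>n\<close>.\<close>

lemma integral_plane_partitions:
  assumes L: "n \<le> L" and q: "0 \<le> q" "q < 1"
  shows "(LINT t|lborel. indicator {-pi..pi} t *\<^sub>R
            (cis (- real n * t) *
             (\<Prod>x\<in>square L. 1 / (1 - cis (u * cell_shift \<delta> x) * (of_real q * cis t) ^ cell_weight x))))
       = 2 * pi * (\<Sum>p\<in>plane_partitions n. cis (u * pp_stat \<delta> p)) * q ^ n"
proof -
  have "(\<Sum>p\<in>plane_partitions n. cis (u * pp_stat \<delta> p)) =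
    (\<Sum>N\<in>weighted_configs cell_weight (square L) n. cis (\<Sum>x\<in>square L. u * cell_shift \<delta> x * real (N x)))"
    unfolding sum_plane_partitions_eq_configs[OF L, where g = "\<lambda>x. cis (u * x)"]
    by (simp add: sum_distrib_left mult.assoc)
  then show ?thesis
    using integral_weighted_configs[of "square L" cell_weight q n "\<lambda>x. u * cell_shift \<delta> x"] q
    by (simp add: cell_weight_def case_prod_unfold)
qed

section \<open>Logarithm of the generating function\<close>

lemma has_sum_product_UNIV:
  fixes f g :: "nat \<Rightarrow> 'a::{real_normed_field, banach}"
  assumes f: "f sums S" "summable (\<lambda>n. norm (f n))" and g: "g sums T" "summable (\<lambda>n. norm (g n))"
  shows "((\<lambda>(a, b). f a * g b) has_sum (S * T)) UNIV"
proof -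
  have F: "(f has_sum S) UNIV" and G: "(g has_sum T) UNIV"
    using f g by (auto intro: norm_summable_imp_has_sum)
  have nG: "((\<lambda>b. norm (g b)) has_sum (\<Sum>b. norm (g b))) UNIV"
    using g(2) by (intro sums_nonneg_imp_has_sum) (auto simp: summable_sums)
  have inner: "((\<lambda>b. norm (case (a, b) of (a, b) \<Rightarrow> f a * g b)) has_sum norm (f a) * (\<Sum>b. norm (g b))) UNIV" for a
    using has_sum_cmult_right[OF nG, of "norm (f a)"] by (simp add: norm_mult)
  have "(\<lambda>x. norm (case x of (a, b) \<Rightarrow> f a * g b)) summable_on (UNIV \<times> UNIV)"
    unfolding Infinite_Sum.abs_summable_on_Sigma_iff
  proof (intro conjI ballI)
    show "(\<lambda>b. norm (case (a, b) of (a, b) \<Rightarrow> f a * g b)) summable_on UNIV" for a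
      using inner by (rule has_sum_imp_summable)
    have "summable (\<lambda>a. norm (norm (f a) * (\<Sum>b. norm (g b))))"
      using f(2) g(2) by (simp add: norm_mult suminf_nonneg summable_mult2)
    then show "(\<lambda>a. norm (infsum (\<lambda>b. norm (case (a, b) of (a, b) \<Rightarrow> f a * g b)) UNIV)) summable_on UNIV"
      unfolding infsumI[OF inner] by (intro norm_summable_imp_summable_on) simp
  qed
  then have "(\<lambda>(a, b). f a * g b) summable_on (UNIV \<times> UNIV)"
    by (rule Infinite_Sum.abs_summable_summable)
  moreover have "((\<lambda>a. f a * T) has_sum S * T) UNIV"
    using F by (rule has_sum_cmult_left)
  moreover have "((\<lambda>b. case (a, b) of (a, b) \<Rightarrow> f a * g b) has_sum f a * T) UNIV" for a
    using has_sum_cmult_right[OF G, of "f a"] by simp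
  ultimately show ?thesis
    by (subst UNIV_Times_UNIV[symmetric], intro has_sum_SigmaI) auto
qed

lemma filterlim_square_finite_subsets:
  "filterlim (\<lambda>L. square L) (finite_subsets_at_top UNIV) sequentially"
  unfolding filterlim_finite_subsets_at_top
proof (intro allI impI)
  fix X :: "(nat \<times> nat) set" assume "finite X \<and> X \<subseteq> UNIV"
  then obtain K where K: "fst ` X \<union> snd ` X \<subseteq> {..<K}"
    using finite_nat_iff_bounded by (metis finite_UnI finite_imageI)
  have "X \<subseteq> square L" if "L \<ge> K" for L
  proof
    fix x assume "x \<in> X"
    then have "fst x < K" "snd x < K" using K by auto
    then show "x \<in> square L" using that by (cases x) auto
  qed
  then show "\<forall>\<^sub>F L in sequentially. finite (square L) \<and> X \<subseteq> square L \<and> square L \<subseteq> UNIV"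
    by (auto simp: eventually_sequentially)
qed

definition cell_term :: "real \<Rightarrow> real \<Rightarrow> real \<Rightarrow> real \<Rightarrow> nat \<times> nat \<Rightarrow> complex" where
  "cell_term \<delta> s t u x = cis (u * cell_shift \<delta> x) * (of_real (exp (- s)) * cis t) ^ cell_weight x"

text \<open>Closed form of the sum of \<open>cell_term\<close> over all cells, the function called
  \<open>A\<close> in the overview; \<open>cell_mass\<close> is its value at
  \<open>t = u = 0\<close>.\<close>

definition cell_sum :: "real \<Rightarrow> real \<Rightarrow> real \<Rightarrow> real \<Rightarrow> complex" where
  "cell_sum \<delta> s t u = cis (\<delta> * u + t) * exp (- s) /
     ((1 - of_real (exp (- s)) * cis (t - u)) * (1 - of_real (exp (- s)) * cis (t + u)))"

definition cell_mass :: "real \<Rightarrow> real" where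
  "cell_mass s = exp (- s) / (1 - exp (- s))\<^sup>2"

lemma cell_sum_0_0: "cell_sum \<delta> s 0 0 = of_real (cell_mass s)"
  by (simp add: cell_sum_def cell_mass_def power2_eq_square)

lemma norm_cell_term: "norm (cell_term \<delta> s t u x) = exp (- s) ^ cell_weight x"
  by (simp add: cell_term_def norm_mult norm_power)

lemma cell_term_0_0: "cell_term \<delta> s 0 0 x = of_real (exp (- s) ^ cell_weight x)"
  by (simp add: cell_term_def)

text \<open>Taking powers scales all three parameters. Hence the power series of the logarithm only
  involves \<open>cell_sum\<close> at multiples of \<open>(s, t, u)\<close>.\<close>

lemma cell_term_power: "cell_term \<delta> s t u x ^ j = cell_term \<delta> (j * s) (j * t) (j * u) x"
proof -
  have "exp (- s) ^ j = exp (- (j * s))" by (simp add: exp_of_nat_mult[symmetric])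
  then have "(complex_of_real (exp (- s)) * cis t) ^ j = of_real (exp (- (j * s))) * cis (j * t)"
    by (metis Complex.DeMoivre of_real_power power_mult_distrib)
  moreover have "((complex_of_real (exp (- s)) * cis t) ^ cell_weight x) ^ j
      = ((complex_of_real (exp (- s)) * cis t) ^ j) ^ cell_weight x"
    by (simp only: power_mult[symmetric] mult.commute)
  ultimately show ?thesis
    unfolding cell_term_def power_mult_distrib Complex.DeMoivre by (simp add: mult.assoc)
qed

lemma cell_term_eq:
  "cell_term \<delta> s t u x = of_real (exp (- s) ^ cell_weight x) * cis (u * cell_shift \<delta> x + real (cell_weight x) * t)"
  unfolding cell_term_def power_mult_distrib Complex.DeMoivre cis_mult[symmetric] by simp

text \<open>The phase is affine in \<open>a\<close> and \<open>b\<close>, with slopes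
  \<open>t - u\<close> and \<open>t + u\<close>, so the double sum splits into two geometric
  series.\<close>

lemma has_sum_cell_term:
  assumes s: "s > 0"
  shows "(cell_term \<delta> s t u has_sum cell_sum \<delta> s t u) UNIV"
proof -
  define q where "q = exp (- s)"
  have q: "0 < q" "q < 1" using s by (auto simp: q_def)
  have geo: "(\<lambda>n. (of_real q * cis v) ^ n) sums (1 / (1 - of_real q * cis v))"
    "summable (\<lambda>n. norm ((of_real q * cis v) ^ n))" for v
    using q by (auto intro!: geometric_sums simp: norm_mult norm_power)
  have "((\<lambda>x. (cis (\<delta> * u + t) * q) * (case x of (a, b) \<Rightarrow> (of_real q * cis (t - u)) ^ a * (of_real q * cis (t + u)) ^ b))
      has_sum (cis (\<delta> * u + t) * q) * ((1 / (1 - of_real q * cis (t - u))) * (1 / (1 - of_real q * cis (t + u))))) UNIV"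
    by (intro has_sum_cmult_right has_sum_product_UNIV geo)
  moreover have "(cis (\<delta> * u + t) * q) * (case x of (a, b) \<Rightarrow> (of_real q * cis (t - u)) ^ a * (of_real q * cis (t + u)) ^ b)
      = cell_term \<delta> s t u x" for x
  proof (cases x)
    case (Pair a b)
    have "u * cell_shift \<delta> x + real (cell_weight x) * t = (\<delta> * u + t) + (real a * (t - u) + real b * (t + u))"
      by (simp add: Pair cell_shift_def cell_weight_def algebra_simps)
    then have "cell_term \<delta> s t u x = q ^ (a + b + 1) * (cis (\<delta> * u + t) * (cis (real a * (t - u)) * cis (real b * (t + u))))"
      unfolding cell_term_eq by (simp add: Pair cell_weight_def q_def cis_mult)
    then show ?thesis
      by (simp add: Pair power_mult_distrib Complex.DeMoivre power_add)
  qed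
  moreover have "(cis (\<delta> * u + t) * q) * ((1 / (1 - of_real q * cis (t - u))) * (1 / (1 - of_real q * cis (t + u)))) = cell_sum \<delta> s t u"
    by (simp add: cell_sum_def q_def)
  ultimately show ?thesis by simp
qed

lemma has_sum_cell_mass:
  assumes s: "s > 0"
  shows "((\<lambda>x. exp (- s) ^ cell_weight x) has_sum cell_mass s) UNIV"
  using has_sum_cell_term[OF s, of 0 0 0] unfolding cell_sum_0_0 cell_term_0_0 has_sum_of_real_iff .

lemma cell_mass_nonneg: "cell_mass s \<ge> 0"
  by (simp add: cell_mass_def)

lemma norm_cell_sum_le:
  assumes s: "s > 0"
  shows "norm (cell_sum \<delta> s t u) \<le> cell_mass s"
  using norm_has_sum_bound[OF _ has_sum_cell_term[OF s, of \<delta> t u]] has_sum_cell_mass[OF s]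
  unfolding norm_cell_term by blast

text \<open>\<open>cell_mass s\<close> equals \<open>1 / (2 * sinh (s / 2))\<^sup>2\<close>, and
  \<open>sinh y \<ge> y\<close> for nonnegative \<open>y\<close>.\<close>

lemma cell_mass_le:
  assumes s: "s > 0"
  shows "cell_mass s \<le> 1 / s\<^sup>2"
proof -
  define h where "h = exp (- (s / 2))"
  have h: "h > 0" "exp (s / 2) * h = 1" "exp (- s) = h\<^sup>2"
    by (simp_all add: h_def exp_minus exp_of_nat_mult[symmetric] power_inverse)
  have "s \<le> exp (s / 2) - h"
    using real_le_x_sinh[of "s / 2"] s by (simp add: h_def exp_minus)
  then have "s * h \<le> (exp (s / 2) - h) * h"
    using h by (intro mult_right_mono) auto
  also have "\<dots> = 1 - h\<^sup>2"
    using h by (simp add: algebra_simps power2_eq_square)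
  finally have *: "s * h \<le> 1 - h\<^sup>2" .
  have "s * h > 0" using s h by simp
  with * have "1 - h\<^sup>2 > 0" by simp
  moreover from * have "(s * h)\<^sup>2 \<le> (1 - h\<^sup>2)\<^sup>2"
    using s h by (intro power_mono) auto
  ultimately show ?thesis
    unfolding cell_mass_def h(3) using s by (simp add: field_simps power_mult_distrib)
qed

lemma sum_cell_term_le:
  assumes s: "s > 0"
  shows "norm (\<Sum>x\<in>square L. cell_term \<delta> s t u x) \<le> cell_mass s"
proof -
  have "norm (\<Sum>x\<in>square L. cell_term \<delta> s t u x) \<le> (\<Sum>x\<in>square L. exp (- s) ^ cell_weight x)"
    using norm_sum[of "cell_term \<delta> s t u" "square L"] by (simp add: norm_cell_term)
  also have "\<dots> \<le> cell_mass s"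
    by (rule has_sum_mono_neutral[OF has_sum_finite has_sum_cell_mass[OF s]]) auto
  finally show ?thesis .
qed

section \<open>The product over all cells and its logarithm\<close>

lemma summable_inverse_Suc_power:
  assumes "p \<ge> 2"
  shows "summable (\<lambda>k. 1 / real (Suc k) ^ p)"
proof -
  have "summable (\<lambda>k. inverse (real (Suc k) ^ p))"
    using inverse_power_summable[OF assms, where 'a = real]
    by (subst summable_Suc_iff[where f = "\<lambda>n. inverse (real n ^ p)"])
  then show ?thesis by (simp only: inverse_eq_divide)
qed

lemma cell_weight_pos: "cell_weight x > 0"
  by (cases x) (simp add: cell_weight_def)

text \<open>A logarithm of the infinite product, defined by its series so that no branch has to be
  chosen.\<close>

definition log_gf :: "real \<Rightarrow> real \<Rightarrow> real \<Rightarrow> real \<Rightarrow> complex" where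
  "log_gf \<delta> s t u = (\<Sum>k. cell_sum \<delta> (real (Suc k) * s) (real (Suc k) * t) (real (Suc k) * u) / of_nat (Suc k))"

text \<open>Stated for arbitrary \<open>z\<close>, so that it serves both finite sums over squares
  and the full \<open>cell_sum\<close>.\<close>

lemma log_gf_term_le:
  fixes z :: complex
  assumes s: "s > 0" and z: "norm z \<le> cell_mass (real (Suc k) * s)"
  shows "norm (z / of_nat (Suc k)) \<le> 1 / s\<^sup>2 * (1 / real (Suc k) ^ 2)"
proof -
  have "norm (z / of_nat (Suc k)) = norm z / real (Suc k)"
    by (simp only: norm_divide norm_of_nat)
  also have "\<dots> \<le> norm z / 1"
    by (intro divide_left_mono) auto
  also have "\<dots> \<le> cell_mass (real (Suc k) * s)" using z by simp
  also have "\<dots> \<le> 1 / (real (Suc k) * s)\<^sup>2"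
    using s by (intro cell_mass_le) auto
  finally show ?thesis by (simp add: power_mult_distrib mult.commute)
qed

lemma summable_log_gf:
  assumes s: "s > 0"
  shows "summable (\<lambda>k. cell_sum \<delta> (real (Suc k) * s) (real (Suc k) * t) (real (Suc k) * u) / of_nat (Suc k))"
proof (rule summable_comparison_test'[where N = 0])
  show "summable (\<lambda>k. 1 / s\<^sup>2 * (1 / real (Suc k) ^ 2))"
    by (intro summable_mult summable_inverse_Suc_power) simp
  show "norm (cell_sum \<delta> (real (Suc k) * s) (real (Suc k) * t) (real (Suc k) * u) / of_nat (Suc k))
      \<le> 1 / s\<^sup>2 * (1 / real (Suc k) ^ 2)" for k
    using s by (intro log_gf_term_le norm_cell_sum_le) auto
qed

text \<open>Expand \<open>- ln (1 - w)\<close> in every cell and interchange the finite sum over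
  cells with the power series.\<close>

lemma prod_cells_eq_exp:
  assumes s: "s > 0"
  shows "(\<Prod>x\<in>square L. 1 / (1 - cell_term \<delta> s t u x)) =
     exp (\<Sum>k. (\<Sum>x\<in>square L. cell_term \<delta> (real (Suc k) * s) (real (Suc k) * t) (real (Suc k) * u) x) / of_nat (Suc k))"
proof -
  have w: "norm (cell_term \<delta> s t u x) < 1" for x
    using s cell_weight_pos[of x] unfolding norm_cell_term by (simp add: power_less_one_iff)
  have "(\<lambda>k. cell_term \<delta> s t u x ^ Suc k / of_nat (Suc k)) sums (- ln (1 - cell_term \<delta> s t u x))" for x
  proof -
    have "(\<lambda>n. - (- ((- (- cell_term \<delta> s t u x)) ^ n) / of_nat n)) sums - ln (1 + (- cell_term \<delta> s t u x))"
      using w[of x] by (intro sums_minus Ln_series') simp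
    then have "(\<lambda>n. cell_term \<delta> s t u x ^ n / of_nat n) sums - ln (1 - cell_term \<delta> s t u x)" by simp
    then show ?thesis 
      by (subst sums_Suc_iff[where f = "\<lambda>n. cell_term \<delta> s t u x ^ n / of_nat n"]) simp
  qed
  then have "(\<lambda>k. \<Sum>x\<in>square L. cell_term \<delta> s t u x ^ Suc k / of_nat (Suc k)) sums (\<Sum>x\<in>square L. - ln (1 - cell_term \<delta> s t u x))"
    by (intro sums_sum)
  then have "(\<Sum>k. (\<Sum>x\<in>square L. cell_term \<delta> s t u x ^ Suc k) / of_nat (Suc k)) = (\<Sum>x\<in>square L. - ln (1 - cell_term \<delta> s t u x))"
    unfolding sum_divide_distrib by (rule sums_unique[symmetric])
  then have "exp (\<Sum>k. (\<Sum>x\<in>square L. cell_term \<delta> s t u x ^ Suc k) / of_nat (Suc k)) = (\<Prod>x\<in>square L. exp (- ln (1 - cell_term \<delta> s t u x)))"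
    by (simp only: exp_sum finite_cartesian_product finite_lessThan)
  also have "\<dots> = (\<Prod>x\<in>square L. 1 / (1 - cell_term \<delta> s t u x))"
  proof (intro prod.cong refl)
    fix x
    have "1 - cell_term \<delta> s t u x \<noteq> 0" using w[of x] by auto
    then show "exp (- ln (1 - cell_term \<delta> s t u x)) = 1 / (1 - cell_term \<delta> s t u x)"
      by (simp add: exp_minus field_simps)
  qed
  finally show ?thesis unfolding cell_term_power by simp
qed

lemma sum_cells_bound:
  assumes s: "s > 0"
  shows "norm ((\<Sum>x\<in>square L. cell_term \<delta> (real (Suc k) * s) (real (Suc k) * t) (real (Suc k) * u) x) / of_nat (Suc k))
     \<le> 1 / s\<^sup>2 * (1 / real (Suc k) ^ 2)"
  using s by (intro log_gf_term_le sum_cell_term_le) auto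

lemma tendsto_prod_cells:
  assumes s: "s > 0"
  shows "(\<lambda>L. \<Prod>x\<in>square L. 1 / (1 - cell_term \<delta> s t u x)) \<longlonglongrightarrow> exp (log_gf \<delta> s t u)"
proof -
  let ?a = "\<lambda>k L. (\<Sum>x\<in>square L. cell_term \<delta> (real (Suc k) * s) (real (Suc k) * t) (real (Suc k) * u) x) / of_nat (Suc k)"
  have lim: "(\<lambda>L. ?a k L) \<longlonglongrightarrow> cell_sum \<delta> (real (Suc k) * s) (real (Suc k) * t) (real (Suc k) * u) / of_nat (Suc k)" for k
  proof -
    have "(cell_term \<delta> (real (Suc k) * s) (real (Suc k) * t) (real (Suc k) * u) has_sum
        cell_sum \<delta> (real (Suc k) * s) (real (Suc k) * t) (real (Suc k) * u)) UNIV"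
      using s by (intro has_sum_cell_term) simp
    then show ?thesis
      unfolding has_sum_def
      by (intro tendsto_divide tendsto_const filterlim_compose[OF _ filterlim_square_finite_subsets])
        (auto simp del: of_nat_Suc)
  qed
  have bound: "\<forall>\<^sub>F (k, L) in at_top \<times>\<^sub>F sequentially. norm (?a k L) \<le> 1 / s\<^sup>2 * (1 / real (Suc k) ^ 2)"
    using sum_cells_bound[OF s] by (intro always_eventually) auto
  have "(\<lambda>L. \<Sum>k. ?a k L) \<longlonglongrightarrow> log_gf \<delta> s t u"
    unfolding log_gf_def
    by (rule tannerys_theorem[OF lim bound, THEN conjunct2, THEN conjunct2])
       (intro summable_mult summable_inverse_Suc_power sequentially_bot; simp)+
  then show ?thesis unfolding prod_cells_eq_exp[OF s] by (rule tendsto_exp)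
qed

text \<open>The bound is uniform in \<open>L\<close> and \<open>t\<close>, as dominated convergence
  on the circle requires.\<close>

lemma norm_prod_cells_le:
  assumes s: "s > 0"
  shows "norm (\<Prod>x\<in>square L. 1 / (1 - cell_term \<delta> s t u x)) \<le> exp (\<Sum>k. 1 / s\<^sup>2 * (1 / real (Suc k) ^ 2))"
proof -
  have sm: "summable (\<lambda>k. 1 / s\<^sup>2 * (1 / real (Suc k) ^ 2))"
    by (intro summable_mult summable_inverse_Suc_power) simp
  have "norm (\<Sum>k. (\<Sum>x\<in>square L. cell_term \<delta> (real (Suc k) * s) (real (Suc k) * t) (real (Suc k) * u) x) / of_nat (Suc k))
      \<le> (\<Sum>k. 1 / s\<^sup>2 * (1 / real (Suc k) ^ 2))"
    using sm by (rule norm_suminf_le[OF sum_cells_bound[OF s]])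
  then show ?thesis unfolding prod_cells_eq_exp[OF s]
    by (intro order_trans[OF norm_exp]) simp
qed

lemma continuous_cell_term: "continuous_on A (\<lambda>t. cell_term \<delta> s t u x)"
  unfolding cell_term_def by (intro continuous_intros)

lemma measurable_prod_cells:
  "(\<lambda>t. \<Prod>x\<in>square L. 1 / (1 - cell_term \<delta> s t u x)) \<in> borel_measurable borel"
  by (intro borel_measurable_prod borel_measurable_divide borel_measurable_diff borel_measurable_const
      borel_measurable_continuous_onI continuous_cell_term)

lemma measurable_exp_log_gf:
  assumes s: "s > 0"
  shows "(\<lambda>t. exp (log_gf \<delta> s t u)) \<in> borel_measurable borel"
  by (rule borel_measurable_LIMSEQ_metric[OF measurable_prod_cells tendsto_prod_cells[OF s]])

text \<open>For \<open>L \<ge> n\<close> the integrals over finite products are constant in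
  \<open>L\<close>; their limit is the integral of the infinite product.\<close>

lemma integral_gf_eq_plane_partitions:
  assumes s: "s > 0"
  shows "(LINT t|lborel. indicator {-pi..pi} t *\<^sub>R (cis (- real n * t) * exp (log_gf \<delta> s t u)))
     = 2 * pi * (\<Sum>p\<in>plane_partitions n. cis (u * pp_stat \<delta> p)) * of_real (exp (- s) ^ n)"
proof -
  let ?P = "\<lambda>L t. \<Prod>x\<in>square L. 1 / (1 - cell_term \<delta> s t u x)"
  let ?B = "exp (\<Sum>k. 1 / s\<^sup>2 * (1 / real (Suc k) ^ 2))"
  have cis_meas: "(\<lambda>t. cis (- real n * t)) \<in> borel_measurable borel"
    by (intro borel_measurable_continuous_onI continuous_intros)
  have lim_meas: "(\<lambda>t. indicator {-pi..pi} t *\<^sub>R (cis (- real n * t) * exp (log_gf \<delta> s t u))) \<in> borel_measurable borel"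
    by (intro borel_measurable_scaleR borel_measurable_times borel_measurable_indicator cis_meas
        measurable_exp_log_gf[OF s]) simp
  have prod_meas: "(\<lambda>t. indicator {-pi..pi} t *\<^sub>R (cis (- real n * t) * ?P L t)) \<in> borel_measurable borel" for L
    by (intro borel_measurable_scaleR borel_measurable_times borel_measurable_indicator cis_meas
        measurable_prod_cells) simp
  have conv: "(\<lambda>L. LINT t|lborel. indicator {-pi..pi} t *\<^sub>R (cis (- real n * t) * ?P L t))
      \<longlonglongrightarrow> (LINT t|lborel. indicator {-pi..pi} t *\<^sub>R (cis (- real n * t) * exp (log_gf \<delta> s t u)))"
  proof (rule integral_dominated_convergence[where w = "\<lambda>t. indicator {-pi..pi} t *\<^sub>R ?B"])
    show "integrable lborel (\<lambda>t. indicator {-pi..pi} t *\<^sub>R ?B)"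
      by (intro borel_integrable_compact continuous_intros) auto
    show "AE t in lborel. (\<lambda>L. indicator {-pi..pi} t *\<^sub>R (cis (- real n * t) * ?P L t))
        \<longlonglongrightarrow> indicator {-pi..pi} t *\<^sub>R (cis (- real n * t) * exp (log_gf \<delta> s t u))"
      by (intro AE_I2 tendsto_scaleR tendsto_mult tendsto_const tendsto_prod_cells[OF s])
    show "AE t in lborel. norm (indicator {-pi..pi} t *\<^sub>R (cis (- real n * t) * ?P L t)) \<le> indicator {-pi..pi} t *\<^sub>R ?B" for L
      using norm_prod_cells_le[OF s, of \<delta> _ u L]
      by (intro AE_I2) (auto simp: norm_mult indicator_def simp del: prod_dividef norm_divide)
  qed (simp_all only: measurable_lborel2 lim_meas prod_meas)
  have ev: "\<forall>\<^sub>F L in sequentially. (LINT t|lborel. indicator {-pi..pi} t *\<^sub>R (cis (- real n * t) * ?P L t))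
      = 2 * pi * (\<Sum>p\<in>plane_partitions n. cis (u * pp_stat \<delta> p)) * of_real (exp (- s) ^ n)"
    using eventually_ge_at_top[of n]
  proof eventually_elim
    case (elim L)
    have "exp (- s) < 1" "exp (- s) \<ge> 0" using s by auto
    from integral_plane_partitions[OF elim this(2,1), of u \<delta>] show ?case
      unfolding cell_term_def by (simp only: of_real_power)
  qed
  show ?thesis by (rule LIMSEQ_unique[OF conv tendsto_eventually[OF ev]])
qed

section \<open>Second order expansion\<close>

lemma sums_power_moments:
  fixes q :: real
  assumes q: "norm q < 1"
  shows "(\<lambda>n. q ^ n) sums (1 / (1 - q))"
    and "(\<lambda>n. real n * q ^ n) sums (q / (1 - q)\<^sup>2)"
    and "(\<lambda>n. real n ^ 2 * q ^ n) sums (q * (1 + q) / (1 - q) ^ 3)"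
proof -
  have r: "1 - q \<noteq> 0" using q by auto
  show 0: "(\<lambda>n. q ^ n) sums (1 / (1 - q))" using q by (rule geometric_sums)
  have gd: "(\<lambda>n. real (Suc n) * z ^ n) sums (1 / (1 - z)\<^sup>2)" if "norm z < 1" for z :: real
    using geometric_deriv_sums[OF that] .
  note 1 = gd[OF q]
  have "((\<lambda>z. 1 / (1 - z)\<^sup>2) has_field_derivative (2 / (1 - q) ^ 3)) (at q)"
    using r by (auto intro!: derivative_eq_intros simp: divide_simps power2_eq_square power3_eq_cube)
  from termdiffs_sums_strong[OF gd this q]
  have 2: "(\<lambda>n. diffs (\<lambda>n. real (Suc n)) n * q ^ n) sums (2 / (1 - q) ^ 3)" .
  have "(\<lambda>n. real (Suc n) * q ^ n - q ^ n) sums (1 / (1 - q)\<^sup>2 - 1 / (1 - q))"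
    by (intro sums_diff 0 1)
  moreover have "real (Suc n) * q ^ n - q ^ n = real n * q ^ n" for n by (simp add: algebra_simps)
  moreover have "1 / (1 - q)\<^sup>2 - 1 / (1 - q) = q / (1 - q)\<^sup>2"
    using r by (simp add: divide_simps power2_eq_square)
  ultimately show "(\<lambda>n. real n * q ^ n) sums (q / (1 - q)\<^sup>2)" by simp
  have "(\<lambda>n. diffs (\<lambda>n. real (Suc n)) n * q ^ n - 3 * (real (Suc n) * q ^ n) + q ^ n)
      sums (2 / (1 - q) ^ 3 - 3 * (1 / (1 - q)\<^sup>2) + 1 / (1 - q))"
    by (intro sums_add sums_diff sums_mult 0 1 2)
  \<comment> \<open>\<open>n\<^sup>2 = (n + 1) * (n + 2) - 3 * (n + 1) + 1\<close>.\<close>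
  moreover have "diffs (\<lambda>n. real (Suc n)) n * q ^ n - 3 * (real (Suc n) * q ^ n) + q ^ n = real n ^ 2 * q ^ n" for n
    by (simp add: diffs_def algebra_simps power2_eq_square)
  moreover have "2 / (1 - q) ^ 3 - 3 * (1 / (1 - q)\<^sup>2) + 1 / (1 - q) = q * (1 + q) / (1 - q) ^ 3"
    using r by (simp add: divide_simps power2_eq_square power3_eq_cube) (simp add: algebra_simps)
  ultimately show "(\<lambda>n. real n ^ 2 * q ^ n) sums (q * (1 + q) / (1 - q) ^ 3)" by simp
qed

text \<open>With \<open>q = exp (- X)\<close>: there are \<open>m\<close> cells of weight
  \<open>m\<close>, so \<open>cell_mom1\<close> is the sum of \<open>m ^ 2 * q ^ m\<close> and
  \<open>cell_mom2\<close> the sum of \<open>m ^ 3 * q ^ m\<close>.\<close>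

definition cell_mom1 :: "real \<Rightarrow> real" where
  "cell_mom1 X = exp (- X) * (1 + exp (- X)) / (1 - exp (- X)) ^ 3"

definition cell_mom2 :: "real \<Rightarrow> real" where
  "cell_mom2 X = exp (- X) * (1 + 4 * exp (- X) + exp (- X) ^ 2) / (1 - exp (- X)) ^ 4"

text \<open>The sum of \<open>(b - a)\<^sup>2 * q ^ (a + b + 1)\<close> over all cells, again with
  \<open>q = exp (- X)\<close>.\<close>

definition cell_momc :: "real \<Rightarrow> real" where
  "cell_momc X = 2 * exp (- X) ^ 2 / (1 - exp (- X)) ^ 4"

definition cell_phase :: "real \<Rightarrow> real \<Rightarrow> real \<Rightarrow> nat \<times> nat \<Rightarrow> real" where
  "cell_phase \<delta> t u x = u * cell_shift \<delta> x + real (cell_weight x) * t"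

text \<open>The phase is affine in \<open>a\<close> and \<open>b\<close>, so products of the
  one-variable moments suffice. Terms odd in \<open>b - a\<close> cancel by symmetry.\<close>

lemma has_sum_cell_phase_moments:
  assumes X: "X > 0"
  shows "((\<lambda>x. exp (- X) ^ cell_weight x * cell_phase \<delta> t u x) has_sum
           (t * cell_mom1 X + \<delta> * u * cell_mass X)) UNIV"
    and "((\<lambda>x. exp (- X) ^ cell_weight x * cell_phase \<delta> t u x ^ 2) has_sum
           (t\<^sup>2 * cell_mom2 X + 2 * t * u * \<delta> * cell_mom1 X + u\<^sup>2 * (cell_momc X + \<delta>\<^sup>2 * cell_mass X))) UNIV"
proof -
  define q where "q = exp (- X)"
  define r where "r = 1 - q"
  have q: "0 < q" "norm q < 1" using X by (auto simp: q_def)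
  have r: "r \<noteq> 0" "q = 1 - r" using q by (auto simp: r_def)
  note mom = sums_power_moments[OF q(2), folded r_def]
  have ab: "summable (\<lambda>n. norm (f n))" if "f sums S" "\<And>n. f n \<ge> 0" for f :: "nat \<Rightarrow> real" and S
    using that by (simp add: sums_iff)
  have h00: "((\<lambda>(a, b). q ^ a * q ^ b) has_sum (1 / r) * (1 / r)) UNIV"
    by (intro has_sum_product_UNIV mom ab[OF mom(1)]) (use q in auto)
  have h10: "((\<lambda>(a, b). (real a * q ^ a) * q ^ b) has_sum (q / r\<^sup>2) * (1 / r)) UNIV"
    by (intro has_sum_product_UNIV mom ab[OF mom(1)] ab[OF mom(2)]) (use q in auto)
  have h01: "((\<lambda>(a, b). q ^ a * (real b * q ^ b)) has_sum (1 / r) * (q / r\<^sup>2)) UNIV"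
    by (intro has_sum_product_UNIV mom ab[OF mom(1)] ab[OF mom(2)]) (use q in auto)
  have h11: "((\<lambda>(a, b). (real a * q ^ a) * (real b * q ^ b)) has_sum (q / r\<^sup>2) * (q / r\<^sup>2)) UNIV"
    by (intro has_sum_product_UNIV mom ab[OF mom(1)] ab[OF mom(2)]) (use q in auto)
  have h20: "((\<lambda>(a, b). (real a ^ 2 * q ^ a) * q ^ b) has_sum (q * (1 + q) / r ^ 3) * (1 / r)) UNIV"
    by (intro has_sum_product_UNIV mom ab[OF mom(1)] ab[OF mom(3)]) (use q in auto)
  have h02: "((\<lambda>(a, b). q ^ a * (real b ^ 2 * q ^ b)) has_sum (1 / r) * (q * (1 + q) / r ^ 3)) UNIV"
    by (intro has_sum_product_UNIV mom ab[OF mom(1)] ab[OF mom(3)]) (use q in auto)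
  define A B C where "A = \<delta> * u + t" and "B = t - u" and "C = t + u"
  have ph: "cell_phase \<delta> t u (a, b) = A + B * real a + C * real b" for a b
    by (simp add: cell_phase_def cell_shift_def cell_weight_def A_def B_def C_def algebra_simps)
  have "((\<lambda>x. (q * A) * (case x of (a, b) \<Rightarrow> q ^ a * q ^ b)
        + (q * B) * (case x of (a, b) \<Rightarrow> (real a * q ^ a) * q ^ b)
        + (q * C) * (case x of (a, b) \<Rightarrow> q ^ a * (real b * q ^ b))) has_sum
      ((q * A) * ((1 / r) * (1 / r)) + (q * B) * ((q / r\<^sup>2) * (1 / r)) + (q * C) * ((1 / r) * (q / r\<^sup>2)))) UNIV"
    by (intro has_sum_add has_sum_cmult_right h00 h10 h01)
  moreover have "(q * A) * (case x of (a, b) \<Rightarrow> q ^ a * q ^ b)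
        + (q * B) * (case x of (a, b) \<Rightarrow> (real a * q ^ a) * q ^ b)
        + (q * C) * (case x of (a, b) \<Rightarrow> q ^ a * (real b * q ^ b))
      = exp (- X) ^ cell_weight x * cell_phase \<delta> t u x" for x
    by (cases x) (simp add: ph cell_weight_def q_def[symmetric] power_add algebra_simps)
  moreover have "(q * A) * ((1 / r) * (1 / r)) + (q * B) * ((q / r\<^sup>2) * (1 / r)) + (q * C) * ((1 / r) * (q / r\<^sup>2))
      = t * cell_mom1 X + \<delta> * u * cell_mass X"
    unfolding cell_mom1_def cell_mass_def q_def[symmetric] r_def[symmetric] A_def B_def C_def r(2)
    using r(1) by (simp add: divide_simps power2_eq_square power3_eq_cube) (simp add: algebra_simps)
  ultimately show "((\<lambda>x. exp (- X) ^ cell_weight x * cell_phase \<delta> t u x) has_sum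
           (t * cell_mom1 X + \<delta> * u * cell_mass X)) UNIV" by simp
  have "((\<lambda>x. (q * A\<^sup>2) * (case x of (a, b) \<Rightarrow> q ^ a * q ^ b)
        + (2 * q * A * B) * (case x of (a, b) \<Rightarrow> (real a * q ^ a) * q ^ b)
        + (2 * q * A * C) * (case x of (a, b) \<Rightarrow> q ^ a * (real b * q ^ b))
        + (2 * q * B * C) * (case x of (a, b) \<Rightarrow> (real a * q ^ a) * (real b * q ^ b))
        + (q * B\<^sup>2) * (case x of (a, b) \<Rightarrow> (real a ^ 2 * q ^ a) * q ^ b)
        + (q * C\<^sup>2) * (case x of (a, b) \<Rightarrow> q ^ a * (real b ^ 2 * q ^ b))) has_sum
      ((q * A\<^sup>2) * ((1 / r) * (1 / r)) + (2 * q * A * B) * ((q / r\<^sup>2) * (1 / r)) + (2 * q * A * C) * ((1 / r) * (q / r\<^sup>2))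
       + (2 * q * B * C) * ((q / r\<^sup>2) * (q / r\<^sup>2))
       + (q * B\<^sup>2) * ((q * (1 + q) / r ^ 3) * (1 / r)) + (q * C\<^sup>2) * ((1 / r) * (q * (1 + q) / r ^ 3)))) UNIV"
    by (intro has_sum_add has_sum_cmult_right h00 h10 h01 h11 h20 h02)
  moreover have "(q * A\<^sup>2) * (case x of (a, b) \<Rightarrow> q ^ a * q ^ b)
        + (2 * q * A * B) * (case x of (a, b) \<Rightarrow> (real a * q ^ a) * q ^ b)
        + (2 * q * A * C) * (case x of (a, b) \<Rightarrow> q ^ a * (real b * q ^ b))
        + (2 * q * B * C) * (case x of (a, b) \<Rightarrow> (real a * q ^ a) * (real b * q ^ b))
        + (q * B\<^sup>2) * (case x of (a, b) \<Rightarrow> (real a ^ 2 * q ^ a) * q ^ b)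
        + (q * C\<^sup>2) * (case x of (a, b) \<Rightarrow> q ^ a * (real b ^ 2 * q ^ b))
      = exp (- X) ^ cell_weight x * cell_phase \<delta> t u x ^ 2" for x
    by (cases x) (simp add: ph cell_weight_def q_def[symmetric] power_add power2_eq_square algebra_simps)
  moreover have "(q * A\<^sup>2) * ((1 / r) * (1 / r)) + (2 * q * A * B) * ((q / r\<^sup>2) * (1 / r)) + (2 * q * A * C) * ((1 / r) * (q / r\<^sup>2))
       + (2 * q * B * C) * ((q / r\<^sup>2) * (q / r\<^sup>2))
       + (q * B\<^sup>2) * ((q * (1 + q) / r ^ 3) * (1 / r)) + (q * C\<^sup>2) * ((1 / r) * (q * (1 + q) / r ^ 3))
      = t\<^sup>2 * cell_mom2 X + 2 * t * u * \<delta> * cell_mom1 X + u\<^sup>2 * (cell_momc X + \<delta>\<^sup>2 * cell_mass X)"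
    unfolding cell_mom1_def cell_mom2_def cell_momc_def cell_mass_def q_def[symmetric] r_def[symmetric] A_def B_def C_def r(2)
    using r(1) by (simp add: divide_simps eval_nat_numeral) (simp add: algebra_simps)
  ultimately show "((\<lambda>x. exp (- X) ^ cell_weight x * cell_phase \<delta> t u x ^ 2) has_sum
           (t\<^sup>2 * cell_mom2 X + 2 * t * u * \<delta> * cell_mom1 X + u\<^sup>2 * (cell_momc X + \<delta>\<^sup>2 * cell_mass X))) UNIV"
    by simp
qed

lemma norm_has_sum_le:
  assumes f: "(f has_sum S) A" and g: "(g has_sum T) A" and le: "\<And>x. x \<in> A \<Longrightarrow> norm (f x) \<le> g x"
  shows "norm S \<le> T"
proof (rule tendsto_le)
  show "(sum g \<longlongrightarrow> T) (finite_subsets_at_top A)" "((\<lambda>F. norm (sum f F)) \<longlongrightarrow> norm S) (finite_subsets_at_top A)"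
    using f g by (auto simp: has_sum_def intro: tendsto_norm)
  show "\<forall>\<^sub>F F in finite_subsets_at_top A. norm (sum f F) \<le> sum g F"
    by (rule eventually_finite_subsets_at_top_weakI) (auto intro!: sum_norm_le le)
qed simp

lemma cell_phase_le: "\<bar>cell_phase \<delta> t u x\<bar> \<le> real (cell_weight x) * (\<bar>t\<bar> + \<bar>u\<bar> * (1 + \<bar>\<delta>\<bar>))"
proof (cases x)
  case (Pair a b)
  define m where "m = real a + real b + 1"
  have "\<bar>\<delta>\<bar> * 1 \<le> \<bar>\<delta>\<bar> * m" unfolding m_def by (intro mult_left_mono) auto
  moreover have "\<bar>\<delta> + real b - real a\<bar> \<le> \<bar>\<delta>\<bar> + m" unfolding m_def by linarith
  ultimately have "\<bar>cell_shift \<delta> x\<bar> \<le> m * (1 + \<bar>\<delta>\<bar>)"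
    by (simp add: Pair cell_shift_def distrib_left mult.commute)
  then have "\<bar>u\<bar> * \<bar>cell_shift \<delta> x\<bar> \<le> \<bar>u\<bar> * (m * (1 + \<bar>\<delta>\<bar>))"
    by (intro mult_left_mono) auto
  moreover have "real (cell_weight x) = m" by (simp add: Pair cell_weight_def m_def)
  then have "\<bar>cell_phase \<delta> t u x\<bar> \<le> \<bar>u\<bar> * \<bar>cell_shift \<delta> x\<bar> + m * \<bar>t\<bar>"
    unfolding cell_phase_def
    using abs_triangle_ineq[of "u * cell_shift \<delta> x" "real (cell_weight x) * t"] by (simp add: abs_mult m_def)
  ultimately show ?thesis by (simp add: Pair cell_weight_def m_def algebra_simps)
qed

lemma cis_taylor2: "norm (cis x - (1 + \<i> * x - x\<^sup>2 / 2)) \<le> \<bar>x\<bar> ^ 3 / 6"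
proof -
  have "(\<Sum>k\<le>2. (\<i> * complex_of_real x) ^ k / fact k) = 1 + \<i> * x - x\<^sup>2 / 2"
  proof -
    have "{..2::nat} = {0, 1, 2}" by auto
    then show ?thesis by (simp add: power_mult_distrib)
  qed
  then show ?thesis using iexp_approx1[of x 2]
    by (simp add: cis_conv_exp fact_numeral)
qed

text \<open>The cubic error terms are summed by trading \<open>m ^ 3\<close> against half of the exponential decay
  \<open>exp (- X m)\<close>, via \<open>(y / 3) ^ 3 \<le> exp y\<close> for \<open>y = X m / 2\<close>.\<close>

lemma cell_sum_taylor:
  assumes X: "X > 0"
  shows "norm (cell_sum \<delta> X t u - (cell_mass X + \<i> * (t * cell_mom1 X + \<delta> * u * cell_mass X)
      - (t\<^sup>2 * cell_mom2 X + 2 * t * u * \<delta> * cell_mom1 X + u\<^sup>2 * (cell_momc X + \<delta>\<^sup>2 * cell_mass X)) / 2))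
    \<le> 144 * (\<bar>t\<bar> + \<bar>u\<bar> * (1 + \<bar>\<delta>\<bar>)) ^ 3 / X ^ 5"
proof -
  define B where "B = \<bar>t\<bar> + \<bar>u\<bar> * (1 + \<bar>\<delta>\<bar>)"
  define M where "M = t * cell_mom1 X + \<delta> * u * cell_mass X"
  define V where "V = t\<^sup>2 * cell_mom2 X + 2 * t * u * \<delta> * cell_mom1 X + u\<^sup>2 * (cell_momc X + \<delta>\<^sup>2 * cell_mass X)"
  let ?q = "\<lambda>x. exp (- X) ^ cell_weight x"
  let ?p = "cell_phase \<delta> t u"
  have B: "B \<ge> 0" by (simp add: B_def)
  have 1: "((\<lambda>x. complex_of_real (?q x * ?p x)) has_sum of_real M) UNIV"
    unfolding has_sum_of_real_iff M_def by (rule has_sum_cell_phase_moments[OF X])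
  have 2: "((\<lambda>x. complex_of_real (?q x * ?p x ^ 2)) has_sum of_real V) UNIV"
    unfolding has_sum_of_real_iff V_def by (rule has_sum_cell_phase_moments[OF X])
  have 0: "((\<lambda>x. complex_of_real (?q x)) has_sum of_real (cell_mass X)) UNIV"
    unfolding has_sum_of_real_iff by (rule has_sum_cell_mass[OF X])
  have "((\<lambda>x. cell_term \<delta> X t u x - (complex_of_real (?q x) + \<i> * complex_of_real (?q x * ?p x)
        - (1 / 2) * complex_of_real (?q x * ?p x ^ 2))) has_sum
      (cell_sum \<delta> X t u - (of_real (cell_mass X) + \<i> * of_real M - (1 / 2) * of_real V))) UNIV"
    unfolding diff_conv_add_uminus
    by (intro has_sum_add has_sum_uminusI has_sum_cmult_right 0 1 2 has_sum_cell_term X)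
  moreover have "((\<lambda>x. 36 * B ^ 3 / X ^ 3 * exp (- (X / 2)) ^ cell_weight x) has_sum
      (36 * B ^ 3 / X ^ 3 * cell_mass (X / 2))) UNIV"
    using X by (intro has_sum_cmult_right has_sum_cell_mass) simp
  moreover have "norm (cell_term \<delta> X t u x - (complex_of_real (?q x) + \<i> * complex_of_real (?q x * ?p x)
        - (1 / 2) * complex_of_real (?q x * ?p x ^ 2))) \<le> 36 * B ^ 3 / X ^ 3 * exp (- (X / 2)) ^ cell_weight x" for x
  proof -
    define m where "m = real (cell_weight x)"
    have m: "m > 0" using cell_weight_pos by (simp add: m_def)
    have pw: "exp (- Y) ^ cell_weight x = exp (- (Y * m))" for Y
      by (simp add: m_def exp_of_nat_mult[symmetric] mult.commute)
    have "cell_term \<delta> X t u x - (complex_of_real (?q x) + \<i> * complex_of_real (?q x * ?p x)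
        - (1 / 2) * complex_of_real (?q x * ?p x ^ 2)) = ?q x * (cis (?p x) - (1 + \<i> * ?p x - (?p x)\<^sup>2 / 2))"
      unfolding cell_term_eq cell_phase_def[symmetric] by (simp add: algebra_simps)
    then have "norm (cell_term \<delta> X t u x - (complex_of_real (?q x) + \<i> * complex_of_real (?q x * ?p x)
        - (1 / 2) * complex_of_real (?q x * ?p x ^ 2))) = ?q x * norm (cis (?p x) - (1 + \<i> * ?p x - (?p x)\<^sup>2 / 2))"
      by (simp only: norm_mult norm_of_real) simp
    also have "\<dots> \<le> ?q x * (\<bar>?p x\<bar> ^ 3 / 6)"
      by (intro mult_left_mono cis_taylor2) simp
    also have "\<dots> \<le> ?q x * ((m * B) ^ 3 / 6)"
      using cell_phase_le[of \<delta> t u x] unfolding m_def B_def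
      by (intro mult_left_mono divide_right_mono power_mono) auto
    \<comment> \<open>\<open>36 = 6 ^ 3 / 6\<close>. The later factor 4, from
      \<open>cell_mass\<close> at \<open>X / 2\<close>, turns it into 144.\<close>
    also have "\<dots> = B ^ 3 * (36 / X ^ 3) * exp (- (X * m)) * ((X * m / 2 / 3) ^ 3)"
      using X unfolding pw by (simp add: power_mult_distrib power_divide field_simps)
    also have "\<dots> \<le> B ^ 3 * (36 / X ^ 3) * exp (- (X * m)) * exp (X * m / 2)"
    proof (intro mult_left_mono)
      define y where "y = X * m / 2 / 3"
      have "0 \<le> y" using X m by (simp add: y_def)
      moreover have "y \<le> exp y" using exp_ge_add_one_self[of y] by linarith
      ultimately have "y ^ 3 \<le> exp y ^ 3" by (intro power_mono)
      also have "exp y ^ 3 = exp (X * m / 2)"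
        unfolding exp_of_nat_mult[symmetric] by (simp add: y_def)
      finally show "(X * m / 2 / 3) ^ 3 \<le> exp (X * m / 2)" unfolding y_def .
    qed (use B X in auto)
    also have "\<dots> = 36 * B ^ 3 / X ^ 3 * (exp (- (X * m)) * exp (X * m / 2))" by simp
    also have "exp (- (X * m)) * exp (X * m / 2) = exp (- (X / 2)) ^ cell_weight x"
      unfolding pw exp_add[symmetric] by (simp add: field_simps)
    finally show ?thesis .
  qed
  ultimately have "norm (cell_sum \<delta> X t u - (of_real (cell_mass X) + \<i> * of_real M - (1 / 2) * of_real V))
      \<le> 36 * B ^ 3 / X ^ 3 * cell_mass (X / 2)"
    by (rule norm_has_sum_le)
  also have "\<dots> \<le> 36 * B ^ 3 / X ^ 3 * (1 / (X / 2)\<^sup>2)"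
    using X B by (intro mult_left_mono cell_mass_le) auto
  also have "\<dots> = 144 * B ^ 3 / X ^ 5"
    using X by (simp add: field_simps eval_nat_numeral)
  finally show ?thesis unfolding M_def V_def B_def by simp
qed

section \<open>Uniform control of the scaled moments\<close>

lemma bounded_on_pos_reals:
  fixes f :: "real \<Rightarrow> real"
  assumes cont: "continuous_on {0<..} f"
    and lim0: "(f \<longlongrightarrow> a) (at_right 0)" and lim1: "(f \<longlongrightarrow> b) at_top"
  shows "\<exists>C. \<forall>X>0. \<bar>f X\<bar> \<le> C"
proof -
  have "\<forall>\<^sub>F X in at_right 0. \<bar>f X\<bar> < \<bar>a\<bar> + 1"
    using tendsto_rabs[OF lim0] by (rule order_tendstoD) simp
  then obtain e where e: "e > 0" "\<And>X. 0 < X \<Longrightarrow> X < e \<Longrightarrow> \<bar>f X\<bar> < \<bar>a\<bar> + 1"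
    unfolding eventually_at_right_field by blast
  have "\<forall>\<^sub>F X in at_top. \<bar>f X\<bar> < \<bar>b\<bar> + 1"
    using tendsto_rabs[OF lim1] by (rule order_tendstoD) simp
  then obtain N where N: "\<And>X. N \<le> X \<Longrightarrow> \<bar>f X\<bar> < \<bar>b\<bar> + 1"
    unfolding eventually_at_top_linorder by blast
  have "compact (f ` {e..N})"
    using e by (intro compact_continuous_image continuous_on_subset[OF cont]) auto
  then obtain C where C: "\<And>X. X \<in> {e..N} \<Longrightarrow> \<bar>f X\<bar> \<le> C"
    using compact_imp_bounded[of "f ` {e..N}"] unfolding bounded_real by blast
  have "\<bar>f X\<bar> \<le> max C (max (\<bar>a\<bar> + 1) (\<bar>b\<bar> + 1))" if "X > 0" for X
  proof -
    consider "X < e" | "N \<le> X" | "X \<in> {e..N}" by fastforce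
    then show ?thesis using e(2)[OF that] N[of X] C[of X] by cases auto
  qed
  then show ?thesis by blast
qed

text \<open>At 0 \<open>cell_mom1\<close> behaves like \<open>2 / X ^ 3\<close>; the subtracted
  \<open>2 / X\<close> is the diverging mean that the choice of \<open>s\<close> cancels. The limits
  1, 6 and 2 are the leading coefficients that survive in the exponent.\<close>

lemma moment_limits_0:
  "((\<lambda>X. X\<^sup>2 * cell_mom1 X - 2 / X) \<longlongrightarrow> 0) (at_right 0)"
  "((\<lambda>X. X\<^sup>2 * cell_mass X) \<longlongrightarrow> 1) (at_right 0)"
  "((\<lambda>X. X ^ 4 * cell_mom2 X) \<longlongrightarrow> 6) (at_right 0)"
  "((\<lambda>X. X ^ 4 * cell_mom1 X) \<longlongrightarrow> 0) (at_right 0)"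
  "((\<lambda>X. X ^ 4 * cell_momc X) \<longlongrightarrow> 2) (at_right 0)"
  "((\<lambda>X. X ^ 4 * cell_mass X) \<longlongrightarrow> 0) (at_right 0)"
  unfolding cell_mom1_def cell_mom2_def cell_momc_def cell_mass_def by real_asymp+

lemma moment_limits_top:
  "((\<lambda>X. X\<^sup>2 * cell_mom1 X - 2 / X) \<longlongrightarrow> 0) at_top"
  "((\<lambda>X. X\<^sup>2 * cell_mass X) \<longlongrightarrow> 0) at_top"
  "((\<lambda>X. X ^ 4 * cell_mom2 X) \<longlongrightarrow> 0) at_top"
  "((\<lambda>X. X ^ 4 * cell_mom1 X) \<longlongrightarrow> 0) at_top"
  "((\<lambda>X. X ^ 4 * cell_momc X) \<longlongrightarrow> 0) at_top"
  "((\<lambda>X. X ^ 4 * cell_mass X) \<longlongrightarrow> 0) at_top"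
  unfolding cell_mom1_def cell_mom2_def cell_momc_def cell_mass_def by real_asymp+

lemma moment_continuous:
  "continuous_on {0<..} (\<lambda>X. X\<^sup>2 * cell_mom1 X - 2 / X)"
  "continuous_on {0<..} (\<lambda>X. X\<^sup>2 * cell_mass X)"
  "continuous_on {0<..} (\<lambda>X. X ^ 4 * cell_mom2 X)"
  "continuous_on {0<..} (\<lambda>X. X ^ 4 * cell_mom1 X)"
  "continuous_on {0<..} (\<lambda>X. X ^ 4 * cell_momc X)"
  "continuous_on {0<..} (\<lambda>X. X ^ 4 * cell_mass X)"
  unfolding cell_mom1_def cell_mom2_def cell_momc_def cell_mass_def
  by (auto intro!: continuous_intros)

text \<open>The argument \<open>k * s\<close> runs through all positive scales, so bounds near 0
  alone would not give a majorant in \<open>k\<close>.\<close>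

lemma moment_bounds:
  obtains C where "C \<ge> 0"
    "\<And>X. X > 0 \<Longrightarrow> \<bar>X\<^sup>2 * cell_mom1 X - 2 / X\<bar> \<le> C"
    "\<And>X. X > 0 \<Longrightarrow> \<bar>X\<^sup>2 * cell_mass X\<bar> \<le> C"
    "\<And>X. X > 0 \<Longrightarrow> \<bar>X ^ 4 * cell_mom2 X\<bar> \<le> C"
    "\<And>X. X > 0 \<Longrightarrow> \<bar>X ^ 4 * cell_mom1 X\<bar> \<le> C"
    "\<And>X. X > 0 \<Longrightarrow> \<bar>X ^ 4 * cell_momc X\<bar> \<le> C"
    "\<And>X. X > 0 \<Longrightarrow> \<bar>X ^ 4 * cell_mass X\<bar> \<le> C"
proof -
  note b = bounded_on_pos_reals[OF moment_continuous(1) moment_limits_0(1) moment_limits_top(1)]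
    bounded_on_pos_reals[OF moment_continuous(2) moment_limits_0(2) moment_limits_top(2)]
    bounded_on_pos_reals[OF moment_continuous(3) moment_limits_0(3) moment_limits_top(3)]
    bounded_on_pos_reals[OF moment_continuous(4) moment_limits_0(4) moment_limits_top(4)]
    bounded_on_pos_reals[OF moment_continuous(5) moment_limits_0(5) moment_limits_top(5)]
    bounded_on_pos_reals[OF moment_continuous(6) moment_limits_0(6) moment_limits_top(6)]
  from b obtain C1 C2 C3 C4 C5 C6 where
    "\<forall>X>0. \<bar>X\<^sup>2 * cell_mom1 X - 2 / X\<bar> \<le> C1"
    "\<forall>X>0. \<bar>X\<^sup>2 * cell_mass X\<bar> \<le> C2"
    "\<forall>X>0. \<bar>X ^ 4 * cell_mom2 X\<bar> \<le> C3"
    "\<forall>X>0. \<bar>X ^ 4 * cell_mom1 X\<bar> \<le> C4"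
    "\<forall>X>0. \<bar>X ^ 4 * cell_momc X\<bar> \<le> C5"
    "\<forall>X>0. \<bar>X ^ 4 * cell_mass X\<bar> \<le> C6" by auto
  then show ?thesis
    by (intro that[of "Max {0, C1, C2, C3, C4, C5, C6}"]) (auto simp: le_max_iff_disj)
qed

lemma zeta_real_sums:
  "(\<lambda>k. 1 / real (Suc k) ^ 2) sums zeta_real 2" "(\<lambda>k. 1 / real (Suc k) ^ 3) sums zeta_real 3"
  unfolding zeta_real_def
  using summable_sums[OF summable_inverse_Suc_power[of 2]] summable_sums[OF summable_inverse_Suc_power[of 3]]
  by (simp_all del: of_nat_Suc)

text \<open>Second order Taylor part of the term with index \<open>K\<close> of the logarithmic
  series at \<open>X = K * s\<close>, after removal of its value at 0 and of its diverging mean. The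
  remaining powers \<open>K\<^sup>2\<close> and \<open>K ^ 3\<close> produce \<open>zeta(2)\<close>
  and \<open>zeta(3)\<close>.\<close>

definition moment_main :: "real \<Rightarrow> real \<Rightarrow> real \<Rightarrow> real \<Rightarrow> real \<Rightarrow> complex" where
  "moment_main \<delta> x y K X =
     \<i> * of_real ((x * (X\<^sup>2 * cell_mom1 X - 2 / X) + \<delta> * y * (X\<^sup>2 * cell_mass X)) / K\<^sup>2)
     - of_real ((x\<^sup>2 * (X ^ 4 * cell_mom2 X) + 2 * x * y * \<delta> * (X ^ 4 * cell_mom1 X)
        + y\<^sup>2 * (X ^ 4 * cell_momc X + \<delta>\<^sup>2 * (X ^ 4 * cell_mass X))) / (2 * K ^ 3))"

lemma moment_main_error:
  fixes \<delta> x y :: real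
  assumes s: "s > 0" and K: "K > 0"
  defines "b \<equiv> \<bar>x\<bar> + \<bar>y\<bar> * (1 + \<bar>\<delta>\<bar>)"
  shows "norm ((cell_sum \<delta> (K * s) (K * (x * s\<^sup>2)) (K * (y * s\<^sup>2)) - cell_mass (K * s)) / of_real K
            - \<i> * of_real (2 * x / (s * K ^ 3)) - moment_main \<delta> x y K (K * s)) \<le> 144 * b ^ 3 * s / K ^ 3"
proof -
  define X where "X = K * s"
  have X: "X > 0" and sX: "s = X / K" using s K by (auto simp: X_def)
  define t u where "t = K * (x * s\<^sup>2)" and "u = K * (y * s\<^sup>2)"
  define T where "T = complex_of_real (cell_mass X) + \<i> * (t * cell_mom1 X + \<delta> * u * cell_mass X)
      - (t\<^sup>2 * cell_mom2 X + 2 * t * u * \<delta> * cell_mom1 X + u\<^sup>2 * (cell_momc X + \<delta>\<^sup>2 * cell_mass X)) / 2"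
  \<comment> \<open>\<open>re\<close> rewrites the first order coefficient, which is multiplied by
    \<open>\<i>\<close>; \<open>im\<close> rewrites the second order one. Both use
    \<open>s = X / K\<close>.\<close>
  have re: "(t * cell_mom1 X + \<delta> * u * cell_mass X) / K - 2 * x / (s * K ^ 3)
      = (x * (X\<^sup>2 * cell_mom1 X - 2 / X) + \<delta> * y * (X\<^sup>2 * cell_mass X)) / K\<^sup>2"
    unfolding t_def u_def sX using K X by (simp add: field_simps eval_nat_numeral)
  have im: "(t\<^sup>2 * cell_mom2 X + 2 * t * u * \<delta> * cell_mom1 X + u\<^sup>2 * (cell_momc X + \<delta>\<^sup>2 * cell_mass X)) / 2 / K
      = (x\<^sup>2 * (X ^ 4 * cell_mom2 X) + 2 * x * y * \<delta> * (X ^ 4 * cell_mom1 X)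
        + y\<^sup>2 * (X ^ 4 * cell_momc X + \<delta>\<^sup>2 * (X ^ 4 * cell_mass X))) / (2 * K ^ 3)"
    unfolding t_def u_def sX using K X by (simp add: field_simps eval_nat_numeral)
  have "(T - cell_mass X) / of_real K - \<i> * of_real (2 * x / (s * K ^ 3)) = moment_main \<delta> x y K X"
    unfolding moment_main_def re[symmetric] im[symmetric] T_def
    by (simp add: diff_divide_distrib right_diff_distrib)
  then have "(cell_sum \<delta> X t u - cell_mass X) / of_real K
            - \<i> * of_real (2 * x / (s * K ^ 3)) - moment_main \<delta> x y K X = (cell_sum \<delta> X t u - T) / of_real K"
    by (simp add: diff_divide_distrib algebra_simps)
  then have "norm ((cell_sum \<delta> X t u - cell_mass X) / of_real K
            - \<i> * of_real (2 * x / (s * K ^ 3)) - moment_main \<delta> x y K X) = norm (cell_sum \<delta> X t u - T) / K"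
    using K by (simp only: norm_divide norm_of_real abs_of_pos)
  also have "\<dots> \<le> (144 * (\<bar>t\<bar> + \<bar>u\<bar> * (1 + \<bar>\<delta>\<bar>)) ^ 3 / X ^ 5) / K"
    using cell_sum_taylor[OF X, of \<delta> t u] K unfolding T_def
    by (intro divide_right_mono) auto
  also have "\<bar>t\<bar> + \<bar>u\<bar> * (1 + \<bar>\<delta>\<bar>) = K * s\<^sup>2 * b"
    unfolding t_def u_def b_def using K by (simp add: abs_mult algebra_simps)
  also have "144 * (K * s\<^sup>2 * b) ^ 3 / X ^ 5 / K = 144 * b ^ 3 * s / K ^ 3"
    unfolding X_def using K s by (simp add: field_simps eval_nat_numeral)
  finally show ?thesis unfolding X_def t_def u_def .
qed

text \<open>Uniformity in \<open>X\<close> makes \<open>C / K\<^sup>2\<close> a summable majorant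
  for Tannery's theorem.\<close>

lemma moment_main_bound:
  obtains C where "C \<ge> 0" "\<And>K X. K \<ge> 1 \<Longrightarrow> X > 0 \<Longrightarrow> norm (moment_main \<delta> x y K X) \<le> C / K\<^sup>2"
proof -
  obtain C where C: "C \<ge> 0"
    "\<And>X. X > 0 \<Longrightarrow> \<bar>X\<^sup>2 * cell_mom1 X - 2 / X\<bar> \<le> C"
    "\<And>X. X > 0 \<Longrightarrow> \<bar>X\<^sup>2 * cell_mass X\<bar> \<le> C"
    "\<And>X. X > 0 \<Longrightarrow> \<bar>X ^ 4 * cell_mom2 X\<bar> \<le> C"
    "\<And>X. X > 0 \<Longrightarrow> \<bar>X ^ 4 * cell_mom1 X\<bar> \<le> C"
    "\<And>X. X > 0 \<Longrightarrow> \<bar>X ^ 4 * cell_momc X\<bar> \<le> C"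
    "\<And>X. X > 0 \<Longrightarrow> \<bar>X ^ 4 * cell_mass X\<bar> \<le> C"
    using moment_bounds by blast
  define A1 where "A1 = \<bar>x\<bar> * C + \<bar>\<delta> * y\<bar> * C"
  define A2 where "A2 = x\<^sup>2 * C + \<bar>2 * x * y * \<delta>\<bar> * C + y\<^sup>2 * (C + \<delta>\<^sup>2 * C)"
  have A: "A1 \<ge> 0" "A2 \<ge> 0" using C(1) by (auto simp: A1_def A2_def)
  have "norm (moment_main \<delta> x y K X) \<le> (A1 + A2) / K\<^sup>2" if K: "K \<ge> 1" and X: "X > 0" for K X
  proof -
    define g1 g2 g3 g4 g5 g6 where "g1 = X\<^sup>2 * cell_mom1 X - 2 / X" and "g2 = X\<^sup>2 * cell_mass X"
      and "g3 = X ^ 4 * cell_mom2 X" and "g4 = X ^ 4 * cell_mom1 X" and "g5 = X ^ 4 * cell_momc X"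
      and "g6 = X ^ 4 * cell_mass X"
    note g = C(2-7)[OF X, folded g1_def g2_def g3_def g4_def g5_def g6_def]
    have 1: "\<bar>x * g1 + \<delta> * y * g2\<bar> \<le> A1"
      unfolding A1_def by (rule order_trans[OF abs_triangle_ineq])
        (auto simp: abs_mult intro!: add_mono mult_left_mono g)
    have "\<bar>x\<^sup>2 * g3\<bar> \<le> x\<^sup>2 * C" "\<bar>2 * x * y * \<delta> * g4\<bar> \<le> \<bar>2 * x * y * \<delta>\<bar> * C"
      "\<bar>y\<^sup>2 * (g5 + \<delta>\<^sup>2 * g6)\<bar> \<le> y\<^sup>2 * (C + \<delta>\<^sup>2 * C)"
      unfolding abs_mult abs_power2
      using g by (auto intro!: mult_left_mono order_trans[OF abs_triangle_ineq] add_mono simp: abs_mult)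
    then have 2: "\<bar>x\<^sup>2 * g3 + 2 * x * y * \<delta> * g4 + y\<^sup>2 * (g5 + \<delta>\<^sup>2 * g6)\<bar> \<le> A2"
      unfolding A2_def by linarith
    have "norm (moment_main \<delta> x y K X) \<le> \<bar>(x * g1 + \<delta> * y * g2) / K\<^sup>2\<bar>
        + \<bar>(x\<^sup>2 * g3 + 2 * x * y * \<delta> * g4 + y\<^sup>2 * (g5 + \<delta>\<^sup>2 * g6)) / (2 * K ^ 3)\<bar>"
      unfolding moment_main_def g1_def[symmetric] g2_def[symmetric] g3_def[symmetric] g4_def[symmetric] g5_def[symmetric] g6_def[symmetric]
      by (rule order_trans[OF norm_triangle_ineq4]) (simp only: norm_mult norm_of_real norm_ii)
    also have "\<bar>(x * g1 + \<delta> * y * g2) / K\<^sup>2\<bar> \<le> A1 / K\<^sup>2"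
      using 1 K by (simp add: divide_right_mono)
    also have "\<bar>(x\<^sup>2 * g3 + 2 * x * y * \<delta> * g4 + y\<^sup>2 * (g5 + \<delta>\<^sup>2 * g6)) / (2 * K ^ 3)\<bar> \<le> A2 / K\<^sup>2"
    proof -
      have "K\<^sup>2 \<le> 2 * K ^ 3" using K power_increasing[of 2 3 K] zero_le_power[of K 3] by linarith
      then have "\<bar>x\<^sup>2 * g3 + 2 * x * y * \<delta> * g4 + y\<^sup>2 * (g5 + \<delta>\<^sup>2 * g6)\<bar> / (2 * K ^ 3) \<le> A2 / K\<^sup>2"
        using 2 A K by (intro frac_le) auto
      then show ?thesis using K by simp
    qed
    finally show ?thesis by (simp add: add_divide_distrib)
  qed
  then show ?thesis using A by (intro that[of "A1 + A2"]) auto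
qed

lemma tendsto_moment_main:
  assumes K: "K > 0"
  shows "((\<lambda>s. moment_main \<delta> x y K (K * s)) \<longlongrightarrow>
     \<i> * of_real (\<delta> * y / K\<^sup>2) - of_real ((3 * x\<^sup>2 + y\<^sup>2) / K ^ 3)) (at_right 0)"
proof -
  have f: "filterlim (\<lambda>s. K * s) (at_right 0) (at_right 0)"
    using K by real_asymp
  have "((\<lambda>X. moment_main \<delta> x y K X) \<longlongrightarrow>
     \<i> * of_real ((x * 0 + \<delta> * y * 1) / K\<^sup>2)
     - of_real ((x\<^sup>2 * 6 + 2 * x * y * \<delta> * 0 + y\<^sup>2 * (2 + \<delta>\<^sup>2 * 0)) / (2 * K ^ 3))) (at_right 0)"
    unfolding moment_main_def using K
    by (intro tendsto_diff tendsto_add tendsto_mult tendsto_of_real tendsto_divide tendsto_const moment_limits_0) auto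
  also have "(x\<^sup>2 * 6 + 2 * x * y * \<delta> * 0 + y\<^sup>2 * (2 + \<delta>\<^sup>2 * 0)) / (2 * K ^ 3) = (3 * x\<^sup>2 + y\<^sup>2) / K ^ 3"
    using K by (simp add: field_simps)
  also have "\<i> * of_real ((x * 0 + \<delta> * y * 1) / K\<^sup>2)
     - complex_of_real ((3 * x\<^sup>2 + y\<^sup>2) / K ^ 3)
     = \<i> * of_real (\<delta> * y / K\<^sup>2) - of_real ((3 * x\<^sup>2 + y\<^sup>2) / K ^ 3)"
    by simp
  finally show ?thesis using f by (rule filterlim_compose)
qed

lemma sums_log_gf_diff:
  assumes s: "s > 0"
  shows "(\<lambda>k. (cell_sum \<delta> (real (Suc k) * s) (real (Suc k) * t) (real (Suc k) * u)
      - of_real (cell_mass (real (Suc k) * s))) / of_real (real (Suc k))) sums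
      (log_gf \<delta> s t u - log_gf \<delta> s 0 0)"
proof -
  have "(\<lambda>k. of_real (cell_mass (real (Suc k) * s)) / of_nat (Suc k)) sums log_gf \<delta> s 0 0"
    using summable_sums[OF summable_log_gf[OF s, of \<delta> 0 0]]
    unfolding log_gf_def mult_zero_right cell_sum_0_0 .
  moreover have "(\<lambda>k. cell_sum \<delta> (real (Suc k) * s) (real (Suc k) * t) (real (Suc k) * u) / of_nat (Suc k)) sums log_gf \<delta> s t u"
    using summable_sums[OF summable_log_gf[OF s, of \<delta> t u]] unfolding log_gf_def .
  ultimately show ?thesis
    unfolding diff_divide_distrib of_real_of_nat_eq by (intro sums_diff)
qed

text \<open>The subtracted mean is spread over the series as \<open>2 * x / (s * k ^ 3)\<close>, so
  that each term converges and is dominated separately.\<close>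

lemma tendsto_log_gf:
  "((\<lambda>s. log_gf \<delta> s (x * s\<^sup>2) (y * s\<^sup>2) - log_gf \<delta> s 0 0 - \<i> * of_real (2 * zeta_real 3 * x / s))
     \<longlongrightarrow> \<i> * of_real (\<delta> * y * zeta_real 2) - of_real ((3 * x\<^sup>2 + y\<^sup>2) * zeta_real 3)) (at_right 0)"
proof -
  define K where "K k = real (Suc k)" for k
  have K: "K k > 0" "K k \<ge> 1" for k by (auto simp: K_def)
  define a where "a k s = (cell_sum \<delta> (K k * s) (K k * (x * s\<^sup>2)) (K k * (y * s\<^sup>2)) - cell_mass (K k * s)) / of_real (K k)
            - \<i> * of_real (2 * x / (s * K k ^ 3))" for k s
  define l where "l k = \<i> * of_real (\<delta> * y / (K k)\<^sup>2) - complex_of_real ((3 * x\<^sup>2 + y\<^sup>2) / K k ^ 3)" for k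
  define b where "b = \<bar>x\<bar> + \<bar>y\<bar> * (1 + \<bar>\<delta>\<bar>)"
  have b: "b \<ge> 0" by (simp add: b_def)
  have err: "norm (a k s - moment_main \<delta> x y (K k) (K k * s)) \<le> 144 * b ^ 3 * s / K k ^ 3" if "s > 0" for k s
    unfolding a_def b_def by (rule moment_main_error[OF that K(1)])
  obtain C where C: "C \<ge> 0" "\<And>K X. K \<ge> 1 \<Longrightarrow> X > 0 \<Longrightarrow> norm (moment_main \<delta> x y K X) \<le> C / K\<^sup>2"
    using moment_main_bound[of \<delta> x y] by blast
  have pos: "\<forall>\<^sub>F s in at_right (0::real). 0 < s \<and> s < 1"
    using eventually_at_right_real[of 0 1] by (auto elim: eventually_mono)
  have lim: "((\<lambda>s. a k s) \<longlongrightarrow> l k) (at_right 0)" for k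
  proof -
    have "((\<lambda>s. a k s - moment_main \<delta> x y (K k) (K k * s)) \<longlongrightarrow> 0) (at_right 0)"
    proof (rule Lim_null_comparison)
      show "\<forall>\<^sub>F s in at_right 0. norm (a k s - moment_main \<delta> x y (K k) (K k * s)) \<le> 144 * b ^ 3 * s / K k ^ 3"
        using pos by (rule eventually_mono) (use err in auto)
      show "((\<lambda>s. 144 * b ^ 3 * s / K k ^ 3) \<longlongrightarrow> 0) (at_right 0)"
        using K(1)[of k] by (auto intro!: tendsto_eq_intros)
    qed
    from tendsto_add[OF this tendsto_moment_main[OF K(1)[of k], of \<delta> x y]] show ?thesis
      by (simp add: l_def)
  qed
  have bd: "norm (a k s) \<le> (C + 144 * b ^ 3) * (1 / (K k)\<^sup>2)" if "0 < s \<and> s < 1" for k s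
  proof -
    have "norm (a k s) \<le> norm (a k s - moment_main \<delta> x y (K k) (K k * s)) + norm (moment_main \<delta> x y (K k) (K k * s))"
      using norm_triangle_sub[of "a k s" "moment_main \<delta> x y (K k) (K k * s)"] by simp
    also have "norm (a k s - moment_main \<delta> x y (K k) (K k * s)) \<le> 144 * b ^ 3 / (K k)\<^sup>2"
    proof -
      have "144 * b ^ 3 * s \<le> 144 * b ^ 3 * 1"
        using b that by (intro mult_left_mono) auto
      moreover have "(K k)\<^sup>2 \<le> K k ^ 3" using K(2) by (intro power_increasing) auto
      ultimately have "144 * b ^ 3 * s / K k ^ 3 \<le> 144 * b ^ 3 / (K k)\<^sup>2"
        using K(1)[of k] b by (intro frac_le) auto
      then show ?thesis using err[of s k] that by linarith
    qed
    also have "norm (moment_main \<delta> x y (K k) (K k * s)) \<le> C / (K k)\<^sup>2"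
      using K that by (intro C) auto
    finally show ?thesis by (simp add: add_divide_distrib distrib_right)
  qed
  have "\<forall>\<^sub>F (k::nat, s) in at_top \<times>\<^sub>F at_right 0. 0 < s \<and> s < (1::real)"
    using pos by (subst eventually_prod2) auto
  then have bound: "\<forall>\<^sub>F (k, s) in at_top \<times>\<^sub>F at_right 0. norm (a k s) \<le> (C + 144 * b ^ 3) * (1 / (K k)\<^sup>2)"
    by (rule eventually_mono) (use bd in auto)
  have sm: "summable (\<lambda>k. (C + 144 * b ^ 3) * (1 / (K k)\<^sup>2))"
    unfolding K_def by (intro summable_mult summable_inverse_Suc_power) simp
  have lim_sum: "((\<lambda>s. \<Sum>k. a k s) \<longlongrightarrow> suminf l) (at_right 0)"
    by (rule tannerys_theorem[OF lim bound sm, THEN conjunct2, THEN conjunct2]) simp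
  have val: "suminf l = \<i> * of_real (\<delta> * y * zeta_real 2) - of_real ((3 * x\<^sup>2 + y\<^sup>2) * zeta_real 3)"
  proof -
    have "(\<lambda>k. \<i> * of_real (\<delta> * y * (1 / real (Suc k) ^ 2)) - complex_of_real ((3 * x\<^sup>2 + y\<^sup>2) * (1 / real (Suc k) ^ 3)))
       sums (\<i> * of_real (\<delta> * y * zeta_real 2) - of_real ((3 * x\<^sup>2 + y\<^sup>2) * zeta_real 3))"
      by (intro sums_diff sums_mult sums_of_real zeta_real_sums)
    then show ?thesis
      unfolding l_def K_def by (simp add: sums_iff del: of_nat_Suc)
  qed
  have ev: "\<forall>\<^sub>F s in at_right 0. (\<Sum>k. a k s) = log_gf \<delta> s (x * s\<^sup>2) (y * s\<^sup>2) - log_gf \<delta> s 0 0 - \<i> * of_real (2 * zeta_real 3 * x / s)"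
    using pos
  proof eventually_elim
    case (elim s)
    have "(\<lambda>k. (cell_sum \<delta> (K k * s) (K k * (x * s\<^sup>2)) (K k * (y * s\<^sup>2)) - cell_mass (K k * s)) / of_real (K k)
        - \<i> * of_real (2 * x / s * (1 / K k ^ 3))) sums
       (log_gf \<delta> s (x * s\<^sup>2) (y * s\<^sup>2) - log_gf \<delta> s 0 0 - \<i> * of_real (2 * x / s * zeta_real 3))"
      unfolding K_def using elim by (intro sums_diff sums_mult sums_of_real zeta_real_sums sums_log_gf_diff) auto
    then show ?case
      unfolding a_def by (simp add: sums_iff mult_ac)
  qed
  show ?thesis using lim_sum unfolding val tendsto_cong[OF ev] .
qed

section \<open>Domination\<close>

text \<open>Every term of the logarithmic series has nonpositive real part after subtracting its value at
  \<open>t = u = 0\<close>, so all but the first may be dropped.\<close>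

lemma Re_log_gf_diff_le:
  assumes s: "s > 0"
  shows "Re (log_gf \<delta> s t u - log_gf \<delta> s 0 0) \<le> norm (cell_sum \<delta> s t u) - cell_mass s"
proof -
  define d where "d k = (cell_sum \<delta> (real (Suc k) * s) (real (Suc k) * t) (real (Suc k) * u)
      - of_real (cell_mass (real (Suc k) * s))) / of_real (real (Suc k))" for k
  have le: "Re (d k) \<le> (norm (cell_sum \<delta> (real (Suc k) * s) (real (Suc k) * t) (real (Suc k) * u)) - cell_mass (real (Suc k) * s)) / real (Suc k)" for k
    unfolding d_def Re_divide_of_real
    by (intro divide_right_mono) (auto simp: complex_Re_le_cmod)
  have "Re (d k) \<le> (if k = 0 then norm (cell_sum \<delta> s t u) - cell_mass s else 0)" for k
  proof (cases "k = 0")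
    case True
    then show ?thesis using le[of 0] by simp
  next
    case False
    have "norm (cell_sum \<delta> (real (Suc k) * s) (real (Suc k) * t) (real (Suc k) * u)) - cell_mass (real (Suc k) * s) \<le> 0"
      using norm_cell_sum_le[of "real (Suc k) * s" \<delta> "real (Suc k) * t" "real (Suc k) * u"] s by simp
    then have "(norm (cell_sum \<delta> (real (Suc k) * s) (real (Suc k) * t) (real (Suc k) * u)) - cell_mass (real (Suc k) * s)) / real (Suc k) \<le> 0"
      by (intro divide_nonpos_nonneg) auto
    then show ?thesis using le[of k] False by simp
  qed
  moreover have "(\<lambda>k. Re (d k)) sums Re (log_gf \<delta> s t u - log_gf \<delta> s 0 0)"
    unfolding d_def by (intro sums_Re sums_log_gf_diff s)
  moreover have "(\<lambda>k. if k = 0 then norm (cell_sum \<delta> s t u) - cell_mass s else 0) sums (norm (cell_sum \<delta> s t u) - cell_mass s)"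
    by (rule sums_single)
  ultimately show ?thesis by (rule sums_le)
qed

text \<open>A rational substitute for the slope \<open>2 / pi\<close>. Up to \<open>pi / 3\<close>
  the derivative \<open>cos\<close> is at least \<open>1 / 2\<close>; beyond, \<open>sin\<close> is
  at least \<open>4 / 5\<close>, while \<open>x < 2\<close>.\<close>

lemma sin_ge_two_fifths:
  assumes "0 \<le> x" "x \<le> pi / 2"
  shows "2 / 5 * x \<le> sin x"
proof (cases "x \<le> pi / 3")
  case True
  have "sin 0 - 2 / 5 * 0 \<le> sin x - 2 / 5 * x"
  proof (rule DERIV_nonneg_imp_nondecreasing[OF assms(1)])
    fix z assume z: "0 \<le> z" "z \<le> x"
    have "cos (pi / 3) \<le> cos z"
      using z True by (intro cos_monotone_0_pi_le) auto
    then show "\<exists>d. ((\<lambda>x. sin x - 2 / 5 * x) has_real_derivative d) (at z) \<and> 0 \<le> d"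
      by (intro exI[of _ "cos z - 2 / 5"]) (auto intro!: derivative_eq_intros simp: cos_60)
  qed
  then show ?thesis by simp
next
  case False
  have "sin (pi / 3) \<le> sin x"
    using False assms by (intro sin_monotone_2pi_le) auto
  moreover have "4 / 5 \<le> sqrt 3 / 2"
    using real_le_rsqrt[of "8 / 5" 3] by (simp add: power2_eq_square)
  moreover have "2 / 5 * x \<le> 4 / 5" using assms pi_less_4 by simp
  ultimately show ?thesis by (simp add: sin_60)
qed

lemma one_minus_cos_ge:
  assumes "\<bar>t\<bar> \<le> pi"
  shows "2 / 25 * t\<^sup>2 \<le> 1 - cos t"
proof -
  have "2 / 5 * (\<bar>t\<bar> / 2) \<le> sin (\<bar>t\<bar> / 2)"
    using assms by (intro sin_ge_two_fifths) auto
  then have "(2 / 5 * (\<bar>t\<bar> / 2))\<^sup>2 \<le> (sin (\<bar>t\<bar> / 2))\<^sup>2"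
    by (intro power_mono) auto
  moreover have "cos t = 1 - 2 * (sin (\<bar>t\<bar> / 2))\<^sup>2"
    using cos_double_sin[of "\<bar>t\<bar> / 2"] by simp
  ultimately show ?thesis by (simp add: power_mult_distrib power_divide)
qed

lemma norm_one_minus_cis:
  "(norm (1 - of_real q * cis \<beta>))\<^sup>2 = (1 - q)\<^sup>2 + 2 * q * (1 - cos \<beta>)"
proof -
  have "(norm (1 - of_real q * cis \<beta>))\<^sup>2 = (1 - q * cos \<beta>)\<^sup>2 + (q * sin \<beta>)\<^sup>2"
    by (simp add: cmod_power2)
  also have "\<dots> = (1 - q)\<^sup>2 + 2 * q * (1 - cos \<beta>)"
    unfolding power_mult_distrib[of q "sin \<beta>"] sin_squared_eq
    by (simp add: power2_eq_square algebra_simps)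
  finally show ?thesis .
qed

text \<open>The square root in \<open>norm (cell_sum) \<le> M / sqrt (1 + v)\<close> is removed by the AM-GM bound
  \<open>z \<le> ((1 + z) / 2)\<^sup>2\<close> with \<open>z = 1 / (1 + v)\<close>.\<close>

lemma norm_cell_sum_decay:
  fixes t :: real
  assumes s: "s > 0" and u: "cos u \<ge> 1 / 2"
  defines "v \<equiv> 2 * cell_mass s * (1 - cos t)"
  shows "norm (cell_sum \<delta> s t u) - cell_mass s \<le> - (cell_mass s / 2 * (v / (1 + v)))"
proof -
  define q a where "q = exp (- s)" and "a = (1 - q)\<^sup>2"
  have q: "0 < q" "q < 1" using s by (auto simp: q_def)
  then have a: "a > 0" by (simp add: a_def)
  have M: "cell_mass s = q / a" by (simp add: cell_mass_def q_def a_def)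
  have v: "v \<ge> 0" unfolding v_def using cell_mass_nonneg[of s] by simp
  define n1 n2 where "n1 = norm (1 - of_real q * cis (t - u))" and "n2 = norm (1 - of_real q * cis (t + u))"
  have n1: "n1\<^sup>2 = a + 2 * q * (1 - cos (t - u))" and n2: "n2\<^sup>2 = a + 2 * q * (1 - cos (t + u))"
    unfolding n1_def n2_def norm_one_minus_cis a_def by auto
  \<comment> \<open>Removes \<open>u\<close>: the right side is the sum of
    \<open>1 - cos (t - u)\<close> and \<open>1 - cos (t + u)\<close>. The hypothesis on
    \<open>cos u\<close> is what handles negative \<open>cos t\<close>.\<close>
  have "1 - cos t \<le> 2 - 2 * (cos t * cos u)"
  proof (cases "cos t \<ge> 0")
    case True
    then have "cos t * cos u \<le> cos t * 1" by (intro mult_left_mono) auto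
    then show ?thesis using cos_le_one[of t] by linarith
  next
    case False
    then have "cos t * cos u \<le> cos t * (1 / 2)" using u by (intro mult_left_mono_neg) auto
    then show ?thesis by linarith
  qed
  then have trig: "1 - cos t \<le> (1 - cos (t - u)) + (1 - cos (t + u))"
    by (simp add: cos_add cos_diff)
  have "a\<^sup>2 * (1 + v) = a\<^sup>2 + 2 * q * a * (1 - cos t)"
    unfolding v_def M using a by (simp add: field_simps power2_eq_square)
  also have "\<dots> \<le> a\<^sup>2 + 2 * q * a * ((1 - cos (t - u)) + (1 - cos (t + u)))"
    using trig q a by (intro add_left_mono mult_left_mono) auto
  also have "\<dots> \<le> a\<^sup>2 + 2 * q * a * ((1 - cos (t - u)) + (1 - cos (t + u)))
      + (2 * q * (1 - cos (t - u))) * (2 * q * (1 - cos (t + u)))"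
    using q by simp
  also have "\<dots> = n1\<^sup>2 * n2\<^sup>2"
    unfolding n1 n2 by (simp add: algebra_simps power2_eq_square)
  finally have prod: "a\<^sup>2 * (1 + v) \<le> n1\<^sup>2 * n2\<^sup>2" .
  have norm: "norm (cell_sum \<delta> s t u) = q / (n1 * n2)"
    unfolding cell_sum_def n1_def n2_def using q by (simp add: norm_divide norm_mult q_def)
  have z: "1 / (1 + v) \<le> ((1 + 1 / (1 + v)) / 2)\<^sup>2"
    using sum_squares_ge_zero[of "1 - 1 / (1 + v)" 0] by (simp add: power2_eq_square algebra_simps)
  have "(norm (cell_sum \<delta> s t u))\<^sup>2 = q\<^sup>2 / (n1\<^sup>2 * n2\<^sup>2)"
    unfolding norm by (simp add: power_divide power_mult_distrib)
  also have "\<dots> \<le> q\<^sup>2 / (a\<^sup>2 * (1 + v))"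
    using prod a v by (intro divide_left_mono) (auto intro!: mult_pos_pos order_less_le_trans[OF _ prod])
  also have "\<dots> = (cell_mass s)\<^sup>2 * (1 / (1 + v))"
    unfolding M by (simp add: power_divide)
  also have "\<dots> \<le> (cell_mass s)\<^sup>2 * ((1 + 1 / (1 + v)) / 2)\<^sup>2"
    using z by (intro mult_left_mono) auto
  also have "\<dots> = (cell_mass s * ((1 + 1 / (1 + v)) / 2))\<^sup>2"
    by (simp only: power_mult_distrib)
  finally have "norm (cell_sum \<delta> s t u) \<le> cell_mass s * ((1 + 1 / (1 + v)) / 2)"
    by (rule power2_le_imp_le) (use v cell_mass_nonneg[of s] in auto)
  also have "\<dots> = cell_mass s - cell_mass s / 2 * (v / (1 + v))"
    using v by (simp add: field_simps)
  finally show ?thesis by simp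
qed

text \<open>The drop is at least \<open>(x\<^sup>2 / 50) / (1 + w)\<close>. As
  \<open>\<bar>s\<^sup>2 * x\<bar> \<le> pi < 4\<close>, \<open>w\<close> is at most
  \<open>8 / 25 * \<bar>x\<bar>\<close>, which leaves linear growth with slope
  \<open>(1 / 50) / (8 / 25) = 1 / 16\<close>.\<close>

lemma norm_exp_log_gf_le:
  assumes s: "s > 0" and M: "s\<^sup>2 * cell_mass s \<ge> 1 / 2" and u: "cos u \<ge> 1 / 2"
    and x: "\<bar>s\<^sup>2 * x\<bar> \<le> pi"
  shows "norm (exp (log_gf \<delta> s (x * s\<^sup>2) u - log_gf \<delta> s 0 0)) \<le> exp (1 - \<bar>x\<bar> / 16)"
proof -
  define v where "v = 2 * cell_mass s * (1 - cos (x * s\<^sup>2))"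
  define w where "w = 2 / 25 * (x\<^sup>2 * s\<^sup>2)"
  have M': "cell_mass s \<ge> 1 / (2 * s\<^sup>2)" using M s by (simp add: field_simps)
  have "2 / 25 * (x * s\<^sup>2)\<^sup>2 \<le> 1 - cos (x * s\<^sup>2)"
    using x by (intro one_minus_cos_ge) (simp add: mult.commute)
  then have "2 * (1 / (2 * s\<^sup>2)) * (2 / 25 * (x * s\<^sup>2)\<^sup>2) \<le> v"
    unfolding v_def using M' cell_mass_nonneg[of s] by (intro mult_mono) auto
  moreover have "2 * (1 / (2 * s\<^sup>2)) * (2 / 25 * (x * s\<^sup>2)\<^sup>2) = w"
    unfolding w_def using s by (simp add: field_simps power2_eq_square)
  ultimately have wv: "w \<le> v" by simp
  have w: "w \<ge> 0" by (simp add: w_def)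
  have "w / (1 + w) \<le> v / (1 + v)"
    using w wv by (simp add: field_simps)
  then have "1 / (2 * s\<^sup>2) / 2 * (w / (1 + w)) \<le> cell_mass s / 2 * (v / (1 + v))"
    using M' w wv s cell_mass_nonneg[of s] by (intro mult_mono divide_right_mono) auto
  moreover have "\<bar>x\<bar> / 16 - 1 \<le> 1 / (2 * s\<^sup>2) / 2 * (w / (1 + w))"
  proof -
    have "x\<^sup>2 * s\<^sup>2 = \<bar>x\<bar> * \<bar>s\<^sup>2 * x\<bar>" by (simp add: abs_mult power2_eq_square)
    also have "\<dots> \<le> \<bar>x\<bar> * 4" using x pi_less_4 by (intro mult_left_mono) auto
    finally have xs: "x\<^sup>2 * s\<^sup>2 \<le> 4 * \<bar>x\<bar>" by simp
    \<comment> \<open>Polynomial division: for nonnegative \<open>z\<close> the two lower terms are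
      negative, so the constant 1 pays for small \<open>\<bar>x\<bar>\<close>.\<close>
    have "(z / 16 - 1) * (1 + 8 / 25 * z) = 1 / 50 * z\<^sup>2 - 103 / 400 * z - 1" for z :: real
      by (simp add: field_simps power2_eq_square)
    from this[of "\<bar>x\<bar>"] have "(\<bar>x\<bar> / 16 - 1) * (1 + 8 / 25 * \<bar>x\<bar>) \<le> 1 / 50 * x\<^sup>2"
      by simp
    then have "\<bar>x\<bar> / 16 - 1 \<le> 1 / 50 * x\<^sup>2 / (1 + 8 / 25 * \<bar>x\<bar>)"
      by (subst pos_le_divide_eq) (auto intro: add_pos_nonneg)
    also have "\<dots> \<le> 1 / 50 * x\<^sup>2 / (1 + w)"
    proof (rule divide_left_mono)
      show "1 + w \<le> 1 + 8 / 25 * \<bar>x\<bar>" using xs by (simp add: w_def mult.commute)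
      show "0 < (1 + 8 / 25 * \<bar>x\<bar>) * (1 + w)" using w by (intro mult_pos_pos add_pos_nonneg) auto
    qed simp
    also have "1 / 50 * x\<^sup>2 = 1 / (2 * s\<^sup>2) / 2 * w"
      unfolding w_def using s by (simp add: field_simps)
    also have "1 / (2 * s\<^sup>2) / 2 * w / (1 + w) = 1 / (2 * s\<^sup>2) / 2 * (w / (1 + w))"
      by simp
    finally show ?thesis .
  qed
  ultimately have "Re (log_gf \<delta> s (x * s\<^sup>2) u - log_gf \<delta> s 0 0) \<le> 1 - \<bar>x\<bar> / 16"
    using Re_log_gf_diff_le[OF s, of \<delta> "x * s\<^sup>2" u] norm_cell_sum_decay[OF s u, of \<delta> "x * s\<^sup>2"]
    unfolding v_def by linarith
  then show ?thesis by (simp add: norm_exp_eq_Re)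
qed

lemma integrable_exp_neg_abs: "integrable lborel (\<lambda>x::real. exp (1 - \<bar>x\<bar> / 16))"
proof (rule Bochner_Integration.integrable_bound)
  have "set_integrable lborel UNIV (\<lambda>x::real. inverse (1 + x\<^sup>2))"
    using integrable_inverse_1_plus_square by simp
  then show "integrable lborel (\<lambda>x::real. 512 * exp 1 * inverse (1 + x\<^sup>2))"
    by (simp add: set_integrable_def)
  show "AE x::real in lborel. norm (exp (1 - \<bar>x\<bar> / 16)) \<le> norm (512 * exp 1 * inverse (1 + x\<^sup>2))"
  proof (intro AE_I2)
    fix x :: real
    \<comment> \<open>\<open>512 = 2 * 16\<^sup>2\<close> makes the quadratic Taylor term equal to
      \<open>x\<^sup>2\<close>.\<close>
    have "1 + x\<^sup>2 \<le> 512 * (1 + \<bar>x\<bar> / 16 + (\<bar>x\<bar> / 16)\<^sup>2 / 2)"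
      by (simp add: power_divide)
    also have "\<dots> \<le> 512 * exp (\<bar>x\<bar> / 16)"
      by (intro mult_left_mono exp_lower_Taylor_quadratic) auto
    finally have "(1 + x\<^sup>2) * exp (- (\<bar>x\<bar> / 16)) \<le> 512"
      by (simp add: exp_minus field_simps)
    then have "exp (- (\<bar>x\<bar> / 16)) \<le> 512 * inverse (1 + x\<^sup>2)"
      by (simp add: inverse_eq_divide pos_le_divide_eq add_pos_nonneg mult.commute)
    from mult_left_mono[OF this, of "exp 1"]
    have "exp (1 - \<bar>x\<bar> / 16) \<le> 512 * exp 1 * inverse (1 + x\<^sup>2)"
      unfolding diff_conv_add_uminus exp_add by (simp add: mult_ac)
    then show "norm (exp (1 - \<bar>x\<bar> / 16)) \<le> norm (512 * exp 1 * inverse (1 + x\<^sup>2))"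
      by (simp add: abs_of_nonneg)
  qed
qed simp

section \<open>Limit law\<close>

lemma zeta_real_3_pos: "zeta_real 3 > 0"
proof -
  have "(\<Sum>k<1. 1 / real (Suc k) ^ 3) \<le> (\<Sum>k. 1 / real (Suc k) ^ 3)"
    using zeta_real_sums(2) by (intro sum_le_suminf) (auto simp: sums_iff simp del: of_nat_Suc)
  then have "1 / real (Suc 0) ^ 3 \<le> zeta_real 3"
    using zeta_real_sums(2) by (simp add: sums_iff del: of_nat_Suc)
  then show ?thesis by simp
qed

text \<open>Solves only the leading order \<open>n = 2 * zeta(3) / s ^ 3\<close> of the saddle point
  equation; the discrepancy in the mean tends to 0 by the first limit in
  \<open>moment_limits_0\<close>.\<close>

definition saddle :: "nat \<Rightarrow> real" where
  "saddle n = (2 * zeta_real 3 / real n) powr (1 / 3)"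

lemma saddle_pos: "n > 0 \<Longrightarrow> saddle n > 0"
  using zeta_real_3_pos by (simp add: saddle_def)

lemma saddle_cubed: "n > 0 \<Longrightarrow> real n * saddle n ^ 3 = 2 * zeta_real 3"
  using zeta_real_3_pos by (simp add: saddle_def powr_realpow[symmetric] powr_powr)

lemma saddle_squared: "n > 0 \<Longrightarrow> (saddle n)\<^sup>2 = (2 * zeta_real 3) powr (2 / 3) / real n powr (2 / 3)"
  using zeta_real_3_pos by (simp add: saddle_def powr_realpow[symmetric] powr_powr powr_divide)

lemma filterlim_saddle: "filterlim (\<lambda>n. saddle (Suc n)) (at_right 0) sequentially"
proof -
  have "filterlim (\<lambda>n. (2 * zeta_real 3 / real (Suc n)) powr (1 / 3)) (at_right 0) sequentially"
    using zeta_real_3_pos by real_asymp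
  then show ?thesis by (simp add: saddle_def)
qed

text \<open>\<open>gf_ratio\<close> is the coefficient integrand after the substitution \<open>t = s\<^sup>2 x\<close>, normalised by the value
  of the generating function at \<open>exp (- s)\<close>; the choice of \<open>s\<close> makes \<open>n s\<^sup>2 x = 2 \<zeta>(3) x / s\<close>, which
  cancels the first moment.\<close>

definition gf_ratio :: "real \<Rightarrow> real \<Rightarrow> real \<Rightarrow> real \<Rightarrow> complex" where
  "gf_ratio \<delta> s y x = indicator {-pi..pi} (s\<^sup>2 * x) *\<^sub>R
     exp (log_gf \<delta> s (x * s\<^sup>2) (y * s\<^sup>2) - log_gf \<delta> s 0 0 - \<i> * of_real (2 * zeta_real 3 * x / s))"

text \<open>The prefactor, Jacobian \<open>s\<^sup>2\<close> times the generating function at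
  \<open>exp (- s)\<close>, is free of \<open>y\<close> and cancels in the quotient.\<close>

lemma plane_partitions_eq_gf_ratio:
  assumes n: "n > 0"
  defines "s \<equiv> saddle n"
  shows "2 * pi * (\<Sum>p\<in>plane_partitions n. cis (y * s\<^sup>2 * pp_stat \<delta> p)) * of_real (exp (- s) ^ n)
     = of_real (s\<^sup>2) * exp (log_gf \<delta> s 0 0) * (LINT x|lborel. gf_ratio \<delta> s y x)"
proof -
  have s: "s > 0" unfolding s_def by (rule saddle_pos[OF n])
  have "2 * pi * (\<Sum>p\<in>plane_partitions n. cis (y * s\<^sup>2 * pp_stat \<delta> p)) * of_real (exp (- s) ^ n)
      = (LINT t|lborel. indicator {-pi..pi} t *\<^sub>R (cis (- real n * t) * exp (log_gf \<delta> s t (y * s\<^sup>2))))"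
    by (rule integral_gf_eq_plane_partitions[OF s, symmetric])
  also have "\<dots> = \<bar>s\<^sup>2\<bar> *\<^sub>R (LINT x|lborel. indicator {-pi..pi} (0 + s\<^sup>2 * x) *\<^sub>R
      (cis (- real n * (0 + s\<^sup>2 * x)) * exp (log_gf \<delta> s (0 + s\<^sup>2 * x) (y * s\<^sup>2))))"
    using s by (intro lborel_integral_real_affine) simp
  also have "(\<lambda>x. indicator {-pi..pi} (0 + s\<^sup>2 * x) *\<^sub>R
      (cis (- real n * (0 + s\<^sup>2 * x)) * exp (log_gf \<delta> s (0 + s\<^sup>2 * x) (y * s\<^sup>2))))
      = (\<lambda>x. exp (log_gf \<delta> s 0 0) * gf_ratio \<delta> s y x)"
  proof
    fix x
    have "real n * (s\<^sup>2 * x) = (real n * s ^ 3) * x / s"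
      using s by (simp add: power2_eq_square power3_eq_cube)
    also have "\<dots> = 2 * zeta_real 3 * x / s"
      unfolding s_def saddle_cubed[OF n] ..
    finally have *: "real n * (s\<^sup>2 * x) = 2 * zeta_real 3 * x / s" .
    have "exp (log_gf \<delta> s 0 0) * exp (log_gf \<delta> s (x * s\<^sup>2) (y * s\<^sup>2) - log_gf \<delta> s 0 0 - \<i> * of_real (2 * zeta_real 3 * x / s))
        = exp (- (\<i> * of_real (real n * (s\<^sup>2 * x)))) * exp (log_gf \<delta> s (s\<^sup>2 * x) (y * s\<^sup>2))"
      unfolding * exp_add[symmetric] by (simp add: mult.commute)
    also have "exp (- (\<i> * of_real (real n * (s\<^sup>2 * x)))) = cis (- real n * (0 + s\<^sup>2 * x))"
      unfolding cis_conv_exp by simp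
    finally show "indicator {-pi..pi} (0 + s\<^sup>2 * x) *\<^sub>R
      (cis (- real n * (0 + s\<^sup>2 * x)) * exp (log_gf \<delta> s (0 + s\<^sup>2 * x) (y * s\<^sup>2)))
      = exp (log_gf \<delta> s 0 0) * gf_ratio \<delta> s y x"
      unfolding gf_ratio_def by simp
  qed
  also have "\<bar>s\<^sup>2\<bar> *\<^sub>R (LINT x|lborel. exp (log_gf \<delta> s 0 0) * gf_ratio \<delta> s y x)
      = of_real (s\<^sup>2) * exp (log_gf \<delta> s 0 0) * (LINT x|lborel. gf_ratio \<delta> s y x)"
    unfolding integral_mult_right_zero by (simp add: scaleR_conv_of_real)
  finally show ?thesis .
qed

lemma measurable_gf_ratio:
  assumes s: "s > 0"
  shows "gf_ratio \<delta> s y \<in> borel_measurable lborel"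
proof -
  have "(\<lambda>x. exp (log_gf \<delta> s (x * s\<^sup>2) (y * s\<^sup>2))) \<in> borel_measurable borel"
    by (rule measurable_compose[OF _ measurable_exp_log_gf[OF s]]) simp
  moreover have "(\<lambda>x. exp (- log_gf \<delta> s 0 0 - \<i> * of_real (2 * zeta_real 3 * x / s))) \<in> borel_measurable borel"
    using s by (intro borel_measurable_continuous_onI continuous_intros) auto
  moreover have "(\<lambda>x. indicator {-pi..pi} (s\<^sup>2 * x) :: real) \<in> borel_measurable borel"
    by (rule measurable_compose[of "\<lambda>x. s\<^sup>2 * x" borel borel, OF _ borel_measurable_indicator]) simp_all
  ultimately have "(\<lambda>x. indicator {-pi..pi} (s\<^sup>2 * x) *\<^sub>R (exp (log_gf \<delta> s (x * s\<^sup>2) (y * s\<^sup>2)) *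
      exp (- log_gf \<delta> s 0 0 - \<i> * of_real (2 * zeta_real 3 * x / s)))) \<in> borel_measurable borel"
    by (intro borel_measurable_scaleR borel_measurable_times)
  moreover have "gf_ratio \<delta> s y = (\<lambda>x. indicator {-pi..pi} (s\<^sup>2 * x) *\<^sub>R (exp (log_gf \<delta> s (x * s\<^sup>2) (y * s\<^sup>2)) *
      exp (- log_gf \<delta> s 0 0 - \<i> * of_real (2 * zeta_real 3 * x / s))))"
    unfolding gf_ratio_def exp_add[symmetric] by (intro ext) (simp add: algebra_simps)
  ultimately show ?thesis by simp
qed

definition gf_limit :: "real \<Rightarrow> real \<Rightarrow> real \<Rightarrow> complex" where
  "gf_limit \<delta> y x = exp (\<i> * of_real (\<delta> * y * zeta_real 2) - of_real ((3 * x\<^sup>2 + y\<^sup>2) * zeta_real 3))"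

lemma tendsto_gf_ratio: "((\<lambda>s. gf_ratio \<delta> s y x) \<longlongrightarrow> gf_limit \<delta> y x) (at_right 0)"
proof -
  have "((\<lambda>s. exp (log_gf \<delta> s (x * s\<^sup>2) (y * s\<^sup>2) - log_gf \<delta> s 0 0 - \<i> * of_real (2 * zeta_real 3 * x / s)))
      \<longlongrightarrow> gf_limit \<delta> y x) (at_right 0)"
    unfolding gf_limit_def by (intro tendsto_exp tendsto_log_gf)
  moreover have "((\<lambda>s. s\<^sup>2 * x) \<longlongrightarrow> 0) (at_right 0)"
    by (auto intro!: tendsto_eq_intros)
  from tendsto_rabs[OF this] have "\<forall>\<^sub>F s in at_right 0. \<bar>s\<^sup>2 * x\<bar> < pi"
    by (rule order_tendstoD) simp
  then have "\<forall>\<^sub>F s in at_right 0. gf_ratio \<delta> s y x =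
      exp (log_gf \<delta> s (x * s\<^sup>2) (y * s\<^sup>2) - log_gf \<delta> s 0 0 - \<i> * of_real (2 * zeta_real 3 * x / s))"
    by (rule eventually_mono) (auto simp: gf_ratio_def indicator_def abs_less_iff)
  ultimately show ?thesis by (simp only: tendsto_cong)
qed

lemma eventually_norm_gf_ratio_le:
  "\<forall>\<^sub>F s in at_right 0. \<forall>x. norm (gf_ratio \<delta> s y x) \<le> exp (1 - \<bar>x\<bar> / 16)"
proof -
  have "((\<lambda>s. cos (y * s\<^sup>2)) \<longlongrightarrow> cos (y * 0\<^sup>2)) (at_right 0)"
    by (intro tendsto_intros)
  then have "\<forall>\<^sub>F s in at_right 0. cos (y * s\<^sup>2) > 1 / 2"
    by (rule order_tendstoD) simp
  moreover have "\<forall>\<^sub>F s in at_right 0. s\<^sup>2 * cell_mass s > 1 / 2"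
    using moment_limits_0(2) by (rule order_tendstoD) simp
  moreover have "\<forall>\<^sub>F s in at_right (0::real). s > 0"
    by (rule eventually_at_right_less)
  ultimately show ?thesis
  proof eventually_elim
    case (elim s)
    show ?case
    proof
      fix x
      show "norm (gf_ratio \<delta> s y x) \<le> exp (1 - \<bar>x\<bar> / 16)"
      proof (cases "\<bar>s\<^sup>2 * x\<bar> \<le> pi")
        case True
        have "norm (gf_ratio \<delta> s y x) \<le> norm (exp (log_gf \<delta> s (x * s\<^sup>2) (y * s\<^sup>2) - log_gf \<delta> s 0 0 - \<i> * of_real (2 * zeta_real 3 * x / s)))"
          unfolding gf_ratio_def by (simp add: indicator_def)
        also have "\<dots> = norm (exp (log_gf \<delta> s (x * s\<^sup>2) (y * s\<^sup>2) - log_gf \<delta> s 0 0))"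
          by (simp add: norm_exp_eq_Re)
        also have "\<dots> \<le> exp (1 - \<bar>x\<bar> / 16)"
          using elim True by (intro norm_exp_log_gf_le) auto
        finally show ?thesis .
      next
        case False
        then have "s\<^sup>2 * x \<notin> {-pi..pi}" by auto
        then show ?thesis by (simp add: gf_ratio_def)
      qed
    qed
  qed
qed

lemma tendsto_integral_gf_ratio:
  "(\<lambda>n. LINT x|lborel. gf_ratio \<delta> (saddle (Suc n)) y x) \<longlonglongrightarrow> (LINT x|lborel. gf_limit \<delta> y x)"
proof -
  have "\<forall>\<^sub>F n in sequentially. \<forall>x. norm (gf_ratio \<delta> (saddle (Suc n)) y x) \<le> exp (1 - \<bar>x\<bar> / 16)"
    using filterlim_saddle eventually_norm_gf_ratio_le by (rule eventually_compose_filterlim[rotated])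
  \<comment> \<open>The majorant holds only for small \<open>s\<close>, so dominated convergence is
    applied to the sequence shifted by \<open>N\<close>.\<close>
  then obtain N where N: "\<And>n x. n \<ge> N \<Longrightarrow> norm (gf_ratio \<delta> (saddle (Suc n)) y x) \<le> exp (1 - \<bar>x\<bar> / 16)"
    by (auto simp: eventually_sequentially)
  have "(\<lambda>n. LINT x|lborel. gf_ratio \<delta> (saddle (Suc (n + N))) y x) \<longlonglongrightarrow> (LINT x|lborel. gf_limit \<delta> y x)"
  proof (rule integral_dominated_convergence[where w = "\<lambda>x. exp (1 - \<bar>x\<bar> / 16)"])
    show "gf_limit \<delta> y \<in> borel_measurable lborel"
      unfolding gf_limit_def measurable_lborel2
      by (intro borel_measurable_continuous_onI continuous_intros)
    show "gf_ratio \<delta> (saddle (Suc (n + N))) y \<in> borel_measurable lborel" for n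
      by (rule measurable_gf_ratio) (simp add: saddle_pos)
    show "AE x in lborel. (\<lambda>n. gf_ratio \<delta> (saddle (Suc (n + N))) y x) \<longlonglongrightarrow> gf_limit \<delta> y x"
    proof (rule AE_I2)
      fix x
      have "(\<lambda>n. gf_ratio \<delta> (saddle (Suc n)) y x) \<longlonglongrightarrow> gf_limit \<delta> y x"
        by (rule filterlim_compose[OF tendsto_gf_ratio filterlim_saddle])
      then show "(\<lambda>n. gf_ratio \<delta> (saddle (Suc (n + N))) y x) \<longlonglongrightarrow> gf_limit \<delta> y x"
        by (rule LIMSEQ_ignore_initial_segment)
    qed
    show "AE x in lborel. norm (gf_ratio \<delta> (saddle (Suc (n + N))) y x) \<le> exp (1 - \<bar>x\<bar> / 16)" for n
      using N[of "n + N"] by (intro AE_I2) simp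
  qed (rule integrable_exp_neg_abs)
  then show ?thesis by (rule LIMSEQ_offset)
qed

lemma integral_gf_limit:
  "(LINT x|lborel. gf_limit \<delta> y x)
     = exp (\<i> * of_real (\<delta> * y * zeta_real 2) - of_real (y\<^sup>2 * zeta_real 3)) * of_real (sqrt (pi / (3 * zeta_real 3)))"
proof -
  \<comment> \<open>Chosen so that \<open>1 / (2 * \<sigma>\<^sup>2) = 3 * zeta_real 3\<close>, the
    coefficient of \<open>x\<^sup>2\<close> in the exponent.\<close>
  define \<sigma> where "\<sigma> = sqrt (1 / (6 * zeta_real 3))"
  have \<sigma>: "\<sigma> > 0" "\<sigma>\<^sup>2 = 1 / (6 * zeta_real 3)" using zeta_real_3_pos by (auto simp: \<sigma>_def)
  have nd: "exp (- (3 * x\<^sup>2 * zeta_real 3)) = sqrt (pi / (3 * zeta_real 3)) * normal_density 0 \<sigma> x" for x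
  proof -
    have "2 * pi * \<sigma>\<^sup>2 = pi / (3 * zeta_real 3)" using \<sigma> zeta_real_3_pos by (simp add: field_simps)
    moreover have "- x\<^sup>2 / (2 * \<sigma>\<^sup>2) = - (3 * x\<^sup>2 * zeta_real 3)" using \<sigma> zeta_real_3_pos by (simp add: field_simps)
    moreover have "sqrt (pi / (3 * zeta_real 3)) \<noteq> 0" using zeta_real_3_pos by simp
    ultimately show ?thesis unfolding normal_density_def by simp
  qed
  have "gf_limit \<delta> y x = exp (\<i> * of_real (\<delta> * y * zeta_real 2) - of_real (y\<^sup>2 * zeta_real 3)) *
      of_real (sqrt (pi / (3 * zeta_real 3)) * normal_density 0 \<sigma> x)" for x
    unfolding nd[symmetric] gf_limit_def exp_of_real[symmetric] exp_add[symmetric] by (simp add: algebra_simps)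
  then have "(LINT x|lborel. gf_limit \<delta> y x) = exp (\<i> * of_real (\<delta> * y * zeta_real 2) - of_real (y\<^sup>2 * zeta_real 3)) *
      of_real (sqrt (pi / (3 * zeta_real 3)) * (LINT x|lborel. normal_density 0 \<sigma> x))"
    by (simp only: integral_mult_right_zero integral_complex_of_real)
  then show ?thesis using integral_normal_density[OF \<sigma>(1)] by simp
qed

section \<open>Characteristic functions\<close>

lemma char_pp_law:
  "char (pp_law \<delta> n) t = (\<Sum>p\<in>plane_partitions n. cis (t / real n powr (2 / 3) * pp_stat \<delta> p)) / of_nat (card (plane_partitions n))"
proof -
  have "char (pp_law \<delta> n) t = (LINT p|measure_pmf (pmf_of_set (plane_partitions n)). iexp (t * (pp_stat \<delta> p / real n powr (2 / 3))))"
    unfolding char_def pp_law_def pp_stat_def by (subst integral_distr) auto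
  also have "\<dots> = (\<Sum>p\<in>plane_partitions n. iexp (t * (pp_stat \<delta> p / real n powr (2 / 3)))) / of_nat (card (plane_partitions n))"
    by (subst integral_measure_pmf[of "plane_partitions n"])
       (auto simp: finite_plane_partitions plane_partitions_nonempty set_pmf_of_set pmf_of_set scaleR_conv_of_real sum_divide_distrib indicator_def)
  also have "(\<Sum>p\<in>plane_partitions n. iexp (t * (pp_stat \<delta> p / real n powr (2 / 3)))) = (\<Sum>p\<in>plane_partitions n. cis (t / real n powr (2 / 3) * pp_stat \<delta> p))"
    by (simp add: cis_conv_exp)
  finally show ?thesis .
qed

text \<open>\<open>y\<close> is scaled so that \<open>y * s\<^sup>2 = t / n powr (2 / 3)\<close>;
  the denominator, at \<open>y = 0\<close>, is the same identity for the cardinality.\<close>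

lemma char_pp_law_eq_gf_ratio:
  fixes t :: real
  assumes n: "n > 0"
  defines "y \<equiv> t / (2 * zeta_real 3) powr (2 / 3)"
  shows "char (pp_law \<delta> n) t = (LINT x|lborel. gf_ratio \<delta> (saddle n) y x) / (LINT x|lborel. gf_ratio \<delta> (saddle n) 0 x)"
proof -
  define s where "s = saddle n"
  define c where "c = complex_of_real (2 * pi * exp (- s) ^ n)"
  define d where "d = of_real (s\<^sup>2) * exp (log_gf \<delta> s 0 0)"
  have s: "s > 0" unfolding s_def by (rule saddle_pos[OF n])
  have cd: "c \<noteq> 0" "d \<noteq> 0" using s by (auto simp: c_def d_def)
  have ys: "y * s\<^sup>2 = t / real n powr (2 / 3)"
    unfolding y_def s_def saddle_squared[OF n] using zeta_real_3_pos by simp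
  have 1: "c * (\<Sum>p\<in>plane_partitions n. cis (t / real n powr (2 / 3) * pp_stat \<delta> p)) = d * (LINT x|lborel. gf_ratio \<delta> s y x)"
    using plane_partitions_eq_gf_ratio[OF n, of y \<delta>, folded s_def] unfolding ys c_def d_def by (simp add: mult_ac)
  have 2: "c * of_nat (card (plane_partitions n)) = d * (LINT x|lborel. gf_ratio \<delta> s 0 x)"
    using plane_partitions_eq_gf_ratio[OF n, of 0 \<delta>, folded s_def] unfolding c_def d_def by (simp add: mult_ac)
  have "char (pp_law \<delta> n) t = (c * (\<Sum>p\<in>plane_partitions n. cis (t / real n powr (2 / 3) * pp_stat \<delta> p))) / (c * of_nat (card (plane_partitions n)))"
    unfolding char_pp_law using cd by simp
  also have "\<dots> = (LINT x|lborel. gf_ratio \<delta> s y x) / (LINT x|lborel. gf_ratio \<delta> s 0 x)"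
    unfolding 1 2 using cd by simp
  finally show ?thesis unfolding s_def .
qed

lemma tendsto_char_pp_law:
  defines "y \<equiv> \<lambda>t. t / (2 * zeta_real 3) powr (2 / 3)"
  shows "(\<lambda>n. char (pp_law \<delta> (Suc n)) t) \<longlonglongrightarrow>
     exp (\<i> * of_real (\<delta> * y t * zeta_real 2) - of_real ((y t)\<^sup>2 * zeta_real 3))"
proof -
  have J: "of_real (sqrt (pi / (3 * zeta_real 3))) \<noteq> (0::complex)" using zeta_real_3_pos by simp
  have "(\<lambda>n. (LINT x|lborel. gf_ratio \<delta> (saddle (Suc n)) (y t) x) / (LINT x|lborel. gf_ratio \<delta> (saddle (Suc n)) 0 x))
      \<longlonglongrightarrow> (LINT x|lborel. gf_limit \<delta> (y t) x) / (LINT x|lborel. gf_limit \<delta> 0 x)"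
    using J by (intro tendsto_divide tendsto_integral_gf_ratio) (simp add: integral_gf_limit)
  moreover have "(LINT x|lborel. gf_limit \<delta> (y t) x) / (LINT x|lborel. gf_limit \<delta> 0 x)
      = exp (\<i> * of_real (\<delta> * y t * zeta_real 2) - of_real ((y t)\<^sup>2 * zeta_real 3))"
    unfolding integral_gf_limit using J by simp
  ultimately show ?thesis by (simp add: char_pp_law_eq_gf_ratio y_def)
qed

lemma char_normal_distribution:
  assumes \<sigma>: "\<sigma> > 0"
  shows "char (density lborel (normal_density \<mu> \<sigma>)) t = exp (\<i> * of_real (t * \<mu>) - of_real ((t * \<sigma>)\<^sup>2 / 2))"
proof -
  let ?M = "density lborel (normal_density \<mu> \<sigma>)"
  interpret prob_space ?M by (rule prob_space_normal_density[OF \<sigma>])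
  have "distributed ?M lborel (\<lambda>x. x) (normal_density \<mu> \<sigma>)"
    unfolding distributed_def by (simp add: distr_id2)
  then have "distributed ?M lborel (\<lambda>x. (x - \<mu>) / \<sigma>) std_normal_density"
    unfolding normal_standard_normal_convert[OF \<sigma>] .
  then have std: "distr ?M lborel (\<lambda>x. (x - \<mu>) / \<sigma>) = std_normal_distribution"
    by (rule distributed_distr_eq_density)
  have "char ?M t = (LINT x|?M. iexp (t * \<mu>) * iexp (t * \<sigma> * ((x - \<mu>) / \<sigma>)))"
    unfolding char_def
  proof (intro Bochner_Integration.integral_cong refl)
    fix x
    have "t * x = t * \<mu> + t * \<sigma> * ((x - \<mu>) / \<sigma>)" using \<sigma> by (simp add: field_simps)
    then show "iexp (t * x) = iexp (t * \<mu>) * iexp (t * \<sigma> * ((x - \<mu>) / \<sigma>))"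
      by (simp only: of_real_add distrib_left exp_add)
  qed
  also have "\<dots> = iexp (t * \<mu>) * (LINT x|?M. iexp (t * \<sigma> * ((x - \<mu>) / \<sigma>)))"
    by (rule integral_mult_right_zero)
  also have "(LINT x|?M. iexp (t * \<sigma> * ((x - \<mu>) / \<sigma>))) = (LINT z|distr ?M lborel (\<lambda>x. (x - \<mu>) / \<sigma>). iexp (t * \<sigma> * z))"
    by (rule integral_distr[symmetric]) auto
  also have "\<dots> = char std_normal_distribution (t * \<sigma>)"
    unfolding std char_def ..
  also have "iexp (t * \<mu>) * char std_normal_distribution (t * \<sigma>) = iexp (t * \<mu>) * exp (of_real (- (t * \<sigma>)\<^sup>2 / 2))"
    unfolding char_std_normal_distribution exp_of_real ..
  also have "\<dots> = exp (\<i> * of_real (t * \<mu>) - of_real ((t * \<sigma>)\<^sup>2 / 2))"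
    unfolding exp_add[symmetric] by simp
  finally show ?thesis .
qed

theorem theorem1:
  fixes \<delta> :: real
  shows "weak_conv_m (\<lambda>n. pp_law \<delta> (Suc n))
           (density lborel (normal_density
              (\<delta> * zeta_real 2 / (2 * zeta_real 3) powr (2/3))
              (sqrt (1 / (2 * zeta_real 3) powr (1/3)))))"
proof (rule levy_continuity)
  let ?\<mu> = "\<delta> * zeta_real 2 / (2 * zeta_real 3) powr (2/3)"
  let ?\<sigma> = "sqrt (1 / (2 * zeta_real 3) powr (1/3))"
  have z: "2 * zeta_real 3 > 0" using zeta_real_3_pos by simp
  then have \<sigma>: "?\<sigma> > 0" by simp
  show "real_distribution (pp_law \<delta> (Suc n))" for n
    unfolding pp_law_def by (rule prob_space.real_distribution_distr[OF measure_pmf.prob_space_axioms]) simp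
  show "real_distribution (density lborel (normal_density ?\<mu> ?\<sigma>))"
    using prob_space_normal_density[OF \<sigma>]
    by (auto simp: real_distribution_def real_distribution_axioms_def)
  show "(\<lambda>n. char (pp_law \<delta> (Suc n)) t) \<longlonglongrightarrow> char (density lborel (normal_density ?\<mu> ?\<sigma>)) t" for t
  proof -
    define y where "y = t / (2 * zeta_real 3) powr (2 / 3)"
    \<comment> \<open>The exponent of the variance:
      \<open>1 - 2 * (2 / 3) = - 1 / 3\<close>.\<close>
    have "y\<^sup>2 * zeta_real 3 = t\<^sup>2 / 2 * ((2 * zeta_real 3) powr 1 / ((2 * zeta_real 3) powr (2 / 3))\<^sup>2)"
      using z by (simp add: y_def power_divide)
    also have "(2 * zeta_real 3) powr 1 / ((2 * zeta_real 3) powr (2 / 3))\<^sup>2 = (2 * zeta_real 3) powr (- (1 / 3))"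
    proof -
      have "((2 * zeta_real 3) powr (2 / 3))\<^sup>2 = (2 * zeta_real 3) powr (4 / 3)"
        unfolding power2_eq_square powr_add[symmetric] by simp
      then show ?thesis by (simp only: powr_diff[symmetric]) simp
    qed
    also have "(2 * zeta_real 3) powr (- (1 / 3)) = ?\<sigma>\<^sup>2"
      using z by (simp add: powr_minus_divide)
    finally have var: "y\<^sup>2 * zeta_real 3 = (t * ?\<sigma>)\<^sup>2 / 2"
      by (simp only: power_mult_distrib times_divide_eq_left)
    have mean: "\<delta> * y * zeta_real 2 = t * ?\<mu>" by (simp add: y_def)
    show ?thesis
      using tendsto_char_pp_law[of \<delta> t, folded y_def]
      unfolding char_normal_distribution[OF \<sigma>] var mean .
  qed
qed

end
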